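(* The sequence of self-financing strategies $(\psi^N)_{N\geq 1}$ (explicitly defined in the context) provides a strong asymptotic arbitrage, without transaction costs (i.e. with $\lambda_N=0$ for all $N$), in the large fractional binary market $\{(\Omega,\mathcal{F},(\mathcal{F}_n)_{n=0}^N,P,S^N)\}_{N\ge 1}$.
   Context: **Model.** Fix $H\in(\frac12,1)$, $\sigma>0$, $s_0>0$. Put $c_H:=\sqrt{\frac{2H\,\Gamma(\frac32-H)}{\Gamma(H+\frac12)\Gamma(2-2H)}}>0$ and $C_H:=(H-\frac12)c_H$. Let $(\xi_i)_{i\ge1}$ be i.i.d. random variables on a probability space $(\Omega,\mathcal{F},P)$ with $P(\xi_1=1)=P(\xi_1=-1)=\frac12$; $\mathcal{F}_0:=\{\emptyset,\Omega\}$, $\mathcal{F}_i:=\sigma(\xi_1,\dots,\xi_i)$ for $i\ge 1$. For $n\ge1$ and $1\le i\le n-1$ let $$j_n(i):=\sigma C_H\int_{i-1}^{i}x^{\frac12-H}\left(\int_0^1(v+n-1)^{H-\frac12}(v+n-1-x)^{H-\frac32}dv\right)dx,$$ $$g_n:=\sigma C_H\int_{n-1}^{n}x^{\frac12-H}(n-x)^{H-\frac12}\left(\int_0^1(y(n-x)+x)^{H-\frac12}y^{H-\frac32}dy\right)dx,$$ $\mathcal{Y}_n:=\sum_{i=1}^{n-1}j_n(i)\xi_i$ (so $\mathcal{Y}_1=0$) and $X_n:=\mathcal{Y}_n+g_n\xi_n$. The $N$-fractional binary market (with zero drift) has bond identically $1$ and stock $S_0^N=s_0$, $S_n^N=\left(1+\frac{X_n}{N^H}\right)S_{n-1}^N$,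 $1\le n\le N$. The sequence of these markets is the large fractional binary market. **Strategies.** For $\lambda\in[0,1]$, a $\lambda$-self-financing strategy for $S^N$ is an adapted process $\varphi^N=(\varphi^{0,N}_n,\varphi^{1,N}_n)_{n=-1}^N$ (bond units, stock units) with, for all $n\in\{0,\dots,N\}$, $$\varphi_n^{0,N}-\varphi_{n-1}^{0,N}\le-(\varphi_n^{1,N}-\varphi_{n-1}^{1,N})^+S_n^N+(1-\lambda)(\varphi_n^{1,N}-\varphi_{n-1}^{1,N})^-S_n^N .$$ Its liquidated value is $V_n^{\lambda}(\varphi^N):=\varphi_n^{0,N}+(1-\lambda)(\varphi_n^{1,N})^+S_n^N-(\varphi_n^{1,N})^-S_n^N$; write $V_n:=V_n^0$. Zero endowment means $\varphi^{0,N}_{-1}=\varphi^{1,N}_{-1}=0$. Given an adapted stock position $\varphi^{1,N}$ and $\varphi_{-1}^{0,N}=0$, the bond position determined by the $\lambda$-self-financing condition with equality is $$\varphi_n^{0,N}=-\sum_{k=0}^n(\varphi^{1,N}_k-\varphi^{1,N}_{k-1})^+S_k^N+(1-\lambda)\sum_{k=0}^n(\varphi^{1,N}_k-\varphi^{1,N}_{k-1})^-S_k^N .$$ **Strong asymptotic arbitrage (SAA) with transaction costs $\{\lambda_N\}$.** There exist a subsequence of markets (again denoted by $N$) and $\lambda_N$-self-financing strategies $\varphi^N$ with zero endowment, and positive reals $c_N\to0$, $C_N\to\infty$, such that (1) $V_i^{\lambda_N}(\varphi^N)\ge -c_N$ for all $i=0,\dots,N$; (2) $\lim_{N\to\infty}P(V_N^{\lambda_N}(\varphi^N)\ge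 C_N)=1$. A given sequence of strategies provides an SAA if it satisfies these conditions for some such $c_N,C_N$. **The strategies $\psi^N$.** Consider $N$ large enough that $S_k^N>0$ for all $0\le k\le N$ (this holds for all sufficiently large $N$). Let $\varphi_{-1}^{1,N}:=\varphi_0^{1,N}:=0$ and $\varphi_k^{1,N}:=N^{H-1}\frac{X_k}{S_k^N}$ for $1\le k\le N$. For $k\ge2$ let $$\theta_k^{(1)}:=g_{k-1}g_k\xi_{k-1}\xi_k,\quad \theta_k^{(2)}:=g_k\xi_k\mathcal{Y}_{k-1},\quad \theta_k^{(3)}:=g_{k-1}\xi_{k-1}\mathcal{Y}_k,\quad \theta_k^{(4)}:=\mathcal{Y}_{k-1}\mathcal{Y}_k,$$ $\theta_1^{(i)}:=0$, and $\mathcal{S}_n^{(i)}:=\sum_{k=1}^n\theta_k^{(i)}$. For $i=1,2$, let $C_i^\theta>0$ be constants with $\sup_{1\le n\le N}|\theta_n^{(i)}|\le C_i^\theta N^{H-\frac12}$ for all $N$ (such constants exist). Put $$\varepsilon_N:=\frac{\ln N}{N^{\frac12\wedge(2-2H)}},\qquad \hat c_N:=4\varepsilon_N+\frac{C_1^\theta+C_2^\theta}{N^{\frac32-H}},$$ $$T^{(N,i)}_{\varepsilon_N}:=\inf\{k\in\{1,\dots,N\}:\tfrac1N\mathcal{S}_k^{(i)}<-\varepsilon_N\}\quad(\inf\emptyset=\infty),$$ $$T_N:=T^{(N,1)}_{\varepsilon_N}\wedge T^{(N,2)}_{\varepsilon_N}\wedge(T^{(N,3)}_{\varepsilon_N}-1)\wedge(T^{(N,4)}_{\varepsilon_N}-1).$$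 The stock position of $\psi^N$ is $\psi_k^{1,N}:=\frac{1}{\sqrt{\hat c_N}}\mathbf{1}_{\{k<T_N\}}\varphi_k^{1,N}$, $k\in\{-1,0,\dots,N\}$; the bond position $\psi^{0,N}$ is determined from it by the self-financing condition with equality, with $\lambda=0$ and $\psi_{-1}^{0,N}=0$. *)

theory Defs
  imports "HOL-Probability.Probability"
begin

section \<open>The fractional binary markets\<close>

definition c_frac :: "real \<Rightarrow> real" where
  "c_frac H = sqrt (2 * H * Gamma (3/2 - H) / (Gamma (H + 1/2) * Gamma (2 - 2 * H)))"

definition C_frac :: "real \<Rightarrow> real" where
  "C_frac H = (H - 1/2) * c_frac H"

(* The integrands of coef_j and coef_g are singular only on null sets, where powr returns 0. *)

definition coef_j :: "real \<Rightarrow> real \<Rightarrow> nat \<Rightarrow> nat \<Rightarrow> real" where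
  "coef_j H \<sigma> n i = \<sigma> * C_frac H *
     (LBINT x:{real i - 1..real i}. x powr (1/2 - H) *
        (LBINT v:{0..1}. (v + real n - 1) powr (H - 1/2) * (v + real n - 1 - x) powr (H - 3/2)))"

definition coef_g :: "real \<Rightarrow> real \<Rightarrow> nat \<Rightarrow> real" where
  "coef_g H \<sigma> n = \<sigma> * C_frac H *
     (LBINT x:{real n - 1..real n}. x powr (1/2 - H) * (real n - x) powr (H - 1/2) *
        (LBINT y:{0..1}. (y * (real n - x) + x) powr (H - 1/2) * y powr (H - 3/2)))"

definition Y_past :: "real \<Rightarrow> real \<Rightarrow> (nat \<Rightarrow> 'a \<Rightarrow> real) \<Rightarrow> nat \<Rightarrow> 'a \<Rightarrow> real" where
  "Y_past H \<sigma> \<xi> n \<omega> = (\<Sum>i\<in>{1..<n}. coef_j H \<sigma> n i * \<xi> i \<omega>)"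

definition X_incr :: "real \<Rightarrow> real \<Rightarrow> (nat \<Rightarrow> 'a \<Rightarrow> real) \<Rightarrow> nat \<Rightarrow> 'a \<Rightarrow> real" where
  "X_incr H \<sigma> \<xi> n \<omega> = Y_past H \<sigma> \<xi> n \<omega> + coef_g H \<sigma> n * \<xi> n \<omega>"

primrec stock ::
  "real \<Rightarrow> real \<Rightarrow> real \<Rightarrow> (nat \<Rightarrow> 'a \<Rightarrow> real) \<Rightarrow> nat \<Rightarrow> nat \<Rightarrow> 'a \<Rightarrow> real" where
  "stock H \<sigma> s0 \<xi> N 0 = (\<lambda>\<omega>. s0)"
| "stock H \<sigma> s0 \<xi> N (Suc n) =
     (\<lambda>\<omega>. (1 + X_incr H \<sigma> \<xi> (Suc n) \<omega> / real N powr H) * stock H \<sigma> s0 \<xi> N n \<omega>)"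

(* For i = 0 there are no generators, so this is the trivial sigma-algebra. *)
definition nat_filt :: "'a measure \<Rightarrow> (nat \<Rightarrow> 'a \<Rightarrow> real) \<Rightarrow> nat \<Rightarrow> 'a measure" where
  "nat_filt M \<xi> i = sigma (space M)
     (\<Union>j\<in>{1..i}. {\<xi> j -` B \<inter> space M | B. B \<in> sets borel})"


section \<open>Self-financing strategies with transaction costs\<close>

text \<open>
  Strategies are indexed by the integers from -1 to N.  Since no information precedes
  time 0, a position held at time -1 must be measurable with respect to the
  sigma-algebra of time 0; this is what \<open>nat (-1) = 0\<close> yields below.
\<close>

definition ppart :: "real \<Rightarrow> real" where "ppart x = max x 0"

definition npart :: "real \<Rightarrow> real" where "npart x = max (- x) 0"

definition self_financing ::
  "'a measure \<Rightarrow> (nat \<Rightarrow> 'a measure) \<Rightarrow> (nat \<Rightarrow> 'a \<Rightarrow> real) \<Rightarrow> real \<Rightarrow> nat \<Rightarrow>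
   (int \<Rightarrow> 'a \<Rightarrow> real) \<Rightarrow> (int \<Rightarrow> 'a \<Rightarrow> real) \<Rightarrow> bool" where
  "self_financing M F S lam N phi0 phi1 \<longleftrightarrow>
     (\<forall>n\<in>{-1..int N}. phi0 n \<in> borel_measurable (F (nat n)) \<and>
                      phi1 n \<in> borel_measurable (F (nat n))) \<and>
     (\<forall>n\<in>{0..int N}. \<forall>\<omega>\<in>space M.
        phi0 n \<omega> - phi0 (n - 1) \<omega> \<le>
          - ppart (phi1 n \<omega> - phi1 (n - 1) \<omega>) * S (nat n) \<omega>
          + (1 - lam) * npart (phi1 n \<omega> - phi1 (n - 1) \<omega>) * S (nat n) \<omega>)"

definition zero_endowment ::
  "'a measure \<Rightarrow> (int \<Rightarrow> 'a \<Rightarrow> real) \<Rightarrow> (int \<Rightarrow> 'a \<Rightarrow> real) \<Rightarrow> bool" where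
  "zero_endowment M phi0 phi1 \<longleftrightarrow>
     (\<forall>\<omega>\<in>space M. phi0 (-1) \<omega> = 0 \<and> phi1 (-1) \<omega> = 0)"

definition liq_value ::
  "(nat \<Rightarrow> 'a \<Rightarrow> real) \<Rightarrow> real \<Rightarrow> (int \<Rightarrow> 'a \<Rightarrow> real) \<Rightarrow> (int \<Rightarrow> 'a \<Rightarrow> real) \<Rightarrow>
   nat \<Rightarrow> 'a \<Rightarrow> real" where
  "liq_value S lam phi0 phi1 n \<omega> =
     phi0 (int n) \<omega> + (1 - lam) * ppart (phi1 (int n) \<omega>) * S n \<omega>
       - npart (phi1 (int n) \<omega>) * S n \<omega>"

definition bond_position ::
  "(nat \<Rightarrow> 'a \<Rightarrow> real) \<Rightarrow> real \<Rightarrow> (int \<Rightarrow> 'a \<Rightarrow> real) \<Rightarrow> int \<Rightarrow> 'a \<Rightarrow> real" where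
  "bond_position S lam phi1 n \<omega> =
     - (\<Sum>k\<in>{0..n}. ppart (phi1 k \<omega> - phi1 (k - 1) \<omega>) * S (nat k) \<omega>)
     + (1 - lam) * (\<Sum>k\<in>{0..n}. npart (phi1 k \<omega> - phi1 (k - 1) \<omega>) * S (nat k) \<omega>)"


section \<open>Strong asymptotic arbitrage\<close>

text \<open>
  The subsequence of markets is given by the strictly increasing map \<open>r\<close>.
  As usual, the lower bound on the value process is required almost surely.
\<close>

definition provides_SAA ::
  "'a measure \<Rightarrow> (nat \<Rightarrow> 'a measure) \<Rightarrow> (nat \<Rightarrow> nat \<Rightarrow> 'a \<Rightarrow> real) \<Rightarrow> (nat \<Rightarrow> real) \<Rightarrow>
   (nat \<Rightarrow> nat) \<Rightarrow> (nat \<Rightarrow> int \<Rightarrow> 'a \<Rightarrow> real) \<Rightarrow> (nat \<Rightarrow> int \<Rightarrow> 'a \<Rightarrow> real) \<Rightarrow> bool" where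
  "provides_SAA M F S lam r phi0 phi1 \<longleftrightarrow>
     strict_mono r \<and>
     (\<forall>m. 1 \<le> r m \<and> 0 \<le> lam (r m) \<and> lam (r m) \<le> 1 \<and>
          self_financing M F (S (r m)) (lam (r m)) (r m) (phi0 (r m)) (phi1 (r m)) \<and>
          zero_endowment M (phi0 (r m)) (phi1 (r m))) \<and>
     (\<exists>c C :: nat \<Rightarrow> real.
        (\<forall>m. 0 < c m \<and> 0 < C m) \<and> c \<longlonglongrightarrow> 0 \<and> filterlim C at_top sequentially \<and>
        (\<forall>m. AE \<omega> in M. \<forall>i\<in>{0..r m}.
           liq_value (S (r m)) (lam (r m)) (phi0 (r m)) (phi1 (r m)) i \<omega> \<ge> - c m) \<and>
        (\<lambda>m. measure M {\<omega> \<in> space M.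
           liq_value (S (r m)) (lam (r m)) (phi0 (r m)) (phi1 (r m)) (r m) \<omega> \<ge> C m})
          \<longlonglongrightarrow> 1)"


section \<open>The strategies\<close>

definition phi_stock ::
  "real \<Rightarrow> real \<Rightarrow> real \<Rightarrow> (nat \<Rightarrow> 'a \<Rightarrow> real) \<Rightarrow> nat \<Rightarrow> int \<Rightarrow> 'a \<Rightarrow> real" where
  "phi_stock H \<sigma> s0 \<xi> N k \<omega> =
     (if k \<le> 0 then 0
      else real N powr (H - 1) * (X_incr H \<sigma> \<xi> (nat k) \<omega> / stock H \<sigma> s0 \<xi> N (nat k) \<omega>))"

text \<open>Only the values 1, 2, 3, 4 of the index \<open>i\<close> are meaningful.\<close>

definition theta :: "real \<Rightarrow> real \<Rightarrow> (nat \<Rightarrow> 'a \<Rightarrow> real) \<Rightarrow> nat \<Rightarrow> nat \<Rightarrow> 'a \<Rightarrow> real" where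
  "theta H \<sigma> \<xi> i k \<omega> =
     (if k < 2 then 0
      else if i = 1 then coef_g H \<sigma> (k - 1) * coef_g H \<sigma> k * \<xi> (k - 1) \<omega> * \<xi> k \<omega>
      else if i = 2 then coef_g H \<sigma> k * \<xi> k \<omega> * Y_past H \<sigma> \<xi> (k - 1) \<omega>
      else if i = 3 then coef_g H \<sigma> (k - 1) * \<xi> (k - 1) \<omega> * Y_past H \<sigma> \<xi> k \<omega>
      else if i = 4 then Y_past H \<sigma> \<xi> (k - 1) \<omega> * Y_past H \<sigma> \<xi> k \<omega>
      else 0)"

definition theta_sum :: "real \<Rightarrow> real \<Rightarrow> (nat \<Rightarrow> 'a \<Rightarrow> real) \<Rightarrow> nat \<Rightarrow> nat \<Rightarrow> 'a \<Rightarrow> real" where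
  "theta_sum H \<sigma> \<xi> i n \<omega> = (\<Sum>k\<in>{1..n}. theta H \<sigma> \<xi> i k \<omega>)"

definition eps :: "real \<Rightarrow> nat \<Rightarrow> real" where
  "eps H N = ln (real N) / real N powr (min (1/2) (2 - 2 * H))"

definition c_hat :: "real \<Rightarrow> real \<Rightarrow> real \<Rightarrow> nat \<Rightarrow> real" where
  "c_hat H C1 C2 N = 4 * eps H N + (C1 + C2) / real N powr (3/2 - H)"

(* In enat, the infimum of the empty set is infinity, and infinity - 1 = infinity. *)

definition hit_time ::
  "real \<Rightarrow> real \<Rightarrow> (nat \<Rightarrow> 'a \<Rightarrow> real) \<Rightarrow> nat \<Rightarrow> nat \<Rightarrow> 'a \<Rightarrow> enat" where
  "hit_time H \<sigma> \<xi> N i \<omega> =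
     Inf (enat ` {k \<in> {1..N}. theta_sum H \<sigma> \<xi> i k \<omega> / real N < - eps H N})"

definition T_stop :: "real \<Rightarrow> real \<Rightarrow> (nat \<Rightarrow> 'a \<Rightarrow> real) \<Rightarrow> nat \<Rightarrow> 'a \<Rightarrow> enat" where
  "T_stop H \<sigma> \<xi> N \<omega> =
     min (min (hit_time H \<sigma> \<xi> N 1 \<omega>) (hit_time H \<sigma> \<xi> N 2 \<omega>))
         (min (hit_time H \<sigma> \<xi> N 3 \<omega> - 1) (hit_time H \<sigma> \<xi> N 4 \<omega> - 1))"

(* Truncating k = -1 to 0 in the indicator is harmless: phi_stock vanishes for k \<le> 0. *)
definition psi_stock ::
  "real \<Rightarrow> real \<Rightarrow> real \<Rightarrow> (nat \<Rightarrow> 'a \<Rightarrow> real) \<Rightarrow> real \<Rightarrow> real \<Rightarrow> nat \<Rightarrow> int \<Rightarrow> 'a \<Rightarrow> real" where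
  "psi_stock H \<sigma> s0 \<xi> C1 C2 N k \<omega> =
     1 / sqrt (c_hat H C1 C2 N) *
     (if enat (nat k) < T_stop H \<sigma> \<xi> N \<omega> then 1 else 0) * phi_stock H \<sigma> s0 \<xi> N k \<omega>"

definition psi_bond ::
  "real \<Rightarrow> real \<Rightarrow> real \<Rightarrow> (nat \<Rightarrow> 'a \<Rightarrow> real) \<Rightarrow> real \<Rightarrow> real \<Rightarrow> nat \<Rightarrow> int \<Rightarrow> 'a \<Rightarrow> real" where
  "psi_bond H \<sigma> s0 \<xi> C1 C2 N =
     bond_position (stock H \<sigma> s0 \<xi> N) 0 (psi_stock H \<sigma> s0 \<xi> C1 C2 N)"

end

theory Submission
  imports Defs
begin

text \<open>
  A trading gain of \<open>psi\<close> is a sum of consecutive products \<open>X (k - 1) * X k\<close>, scaled by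
  \<open>1 / (N * sqrt c_hat)\<close>; the four \<open>theta\<close> terms are the expansion of this product.  The lower
  bound on the value is pathwise: before the stopping time none of the four averages has
  fallen below \<open>- eps\<close>, and only the first two can overshoot, by one bounded summand.  So the
  value never falls below \<open>- sqrt c_hat\<close> (\<open>psi_value_lower_bound\<close>).

  For the gain it must be shown that with probability tending to 1 the strategy is never stopped
  and the total average stays above a positive constant.  The increments are positively
  correlated, and this correlation is extracted as a deterministic drift; everything else is
  either nonnegative, deterministically small, or a martingale.  Concretely:
  \<^item> The sums of \<open>theta 1\<close> and \<open>theta 2\<close> are martingale transforms of the signs, and
    that of \<open>theta 3\<close> is one plus nonnegative terms.
  \<^item> For \<open>theta 4\<close>, the product \<open>Y (k - 1) * Y k\<close>, fix a window length \<open>m\<close> and reveal the last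
    \<open>m\<close> signs one at a time.  Telescoping writes the product as the product of the two remote
    parts, plus \<open>m\<close> martingale increments, plus a diagonal sum of products of coefficients
    (\<open>consecutive_product_lower_bound\<close>).  From the third step on, the
    weight of the most recent signs bounds the diagonal below by a constant \<open>b0 ^ 2 > 0\<close>.
    A product of two numbers is at least minus half the square of their difference, and the
    remote parts of \<open>Y (k - 1)\<close> and \<open>Y k\<close> differ by at most \<open>b0\<close> once \<open>m\<close> is large
    (\<open>coef_j_remote_increments_small\<close>).  So a drift of \<open>b0 ^ 2 / 2\<close> per step remains.

  The number \<open>m + 3\<close> of martingales does not depend on \<open>N\<close>, and their increments have
  uniformly bounded second moments because the coefficients are uniformly square summable
  (\<open>coef_j_square_sum_bounded\<close>).  Kolmogorov's inequality (\<open>maximal_inequality\<close>) bounds the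
  probability that one of them reaches a fixed fraction of \<open>N * eps\<close> by a constant times
  \<open>1 / (N * eps ^ 2)\<close>, which is at most a constant times \<open>1 / (ln N) ^ 2\<close>.
\<close>

section \<open>Integrals of powers over unit intervals\<close>

lemma set_integral_nonneg:
  fixes f :: "'b \<Rightarrow> real"
  assumes "\<And>x. x \<in> A \<Longrightarrow> 0 \<le> f x"
  shows "0 \<le> (LINT x:A|L. f x)"
  unfolding set_lebesgue_integral_def
  using assms by (intro Bochner_Integration.integral_nonneg) (auto simp: indicator_def)

lemma set_integrable_powr_shift:
  fixes a p :: real assumes "-1 < p"
  shows "set_integrable lborel {a..a+1} (\<lambda>x. (x - a) powr p)"
    and "(LBINT x:{a..a+1}. (x - a) powr p) = 1 / (p + 1)"
proof -
  have hi: "((\<lambda>x. x powr p) has_integral (1 / (p + 1))) {0..1}"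
    using has_integral_powr_from_0[of p 1] assms by simp
  have "(\<lambda>x::real. x powr p) absolutely_integrable_on {0..1}"
    using hi by (intro nonnegative_absolutely_integrable_1) (auto simp: integrable_on_def)
  then have si0: "set_integrable lborel {0..1} (\<lambda>x::real. x powr p)"
    unfolding set_integrable_def by (subst (asm) integrable_completion) auto
  have v0: "(LBINT x:{0..1}. x powr p) = 1 / (p + 1)"
    using set_borel_integral_eq_integral(2)[OF si0] integral_unique[OF hi] by simp
  have ind: "indicator {a..a+1} (a + 1 * x) = (indicator {0..1} x :: real)" for x
    by (auto simp: indicator_def)
  have "integrable lborel (\<lambda>x. indicator {a..a+1} (a + 1 * x) *\<^sub>R ((a + 1 * x) - a) powr p)"
    using si0 unfolding set_integrable_def by (simp only: ind) simp
  then show "set_integrable lborel {a..a+1} (\<lambda>x. (x - a) powr p)"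
    unfolding set_integrable_def
    using lborel_integrable_real_affine_iff[of 1 "\<lambda>x. indicator {a..a+1} x *\<^sub>R (x - a) powr p" a]
    by simp
  show "(LBINT x:{a..a+1}. (x - a) powr p) = 1 / (p + 1)"
    unfolding set_lebesgue_integral_def
    using lborel_integral_real_affine[of 1 "\<lambda>x. indicator {a..a+1} x *\<^sub>R (x - a) powr p" a] v0
    unfolding set_lebesgue_integral_def by (simp only: ind) simp
qed

lemma set_integrable_powr_unit:
  fixes p :: real assumes "-1 < p"
  shows "set_integrable lborel {0..1} (\<lambda>x. x powr p)"
    and "(LBINT x:{0..1}. x powr p) = 1 / (p + 1)"
  using set_integrable_powr_shift[of p 0] assms by auto

lemma set_integrable_powr_cell:
  fixes p :: real assumes "-1 < p" and "1 \<le> i"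
  shows "set_integrable lborel {real i - 1..real i} (\<lambda>x. (x - (real i - 1)) powr p)"
    and "(LBINT x:{real i - 1..real i}. (x - (real i - 1)) powr p) = 1 / (p + 1)"
  using set_integrable_powr_shift[of p "real i - 1"] assms by (auto simp: algebra_simps)

lemma set_integral_const_unit_interval:
  "(LBINT x:{real i - 1..real i}. (c::real)) = c" "set_integrable lborel {real i - 1..real i} (\<lambda>x. c::real)"
  "(LBINT x:{0..1::real}. (c::real)) = c" "set_integrable lborel {0..1::real} (\<lambda>x. c::real)"
  by (auto simp: set_lebesgue_integral_def set_integrable_def content_real)

section \<open>The coefficients of the price increments\<close>
definition kern :: "real \<Rightarrow> nat \<Rightarrow> real \<Rightarrow> real \<Rightarrow> real" where
  "kern H n x v = (v + real n - 1) powr (H - 1/2) * (v + real n - 1 - x) powr (H - 3/2)"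

definition kern_integral :: "real \<Rightarrow> nat \<Rightarrow> real \<Rightarrow> real" where
  "kern_integral H n x = (LBINT v:{0..1}. kern H n x v)"

lemma coef_j_eq:
  "coef_j H \<sigma> n i = \<sigma> * C_frac H * (LBINT x:{real i - 1..real i}. x powr (1/2 - H) * kern_integral H n x)"
  by (simp add: coef_j_def kern_integral_def kern_def)

lemma C_frac_pos: assumes "1/2 < H" "H < 1" shows "0 < C_frac H"
  using assms unfolding C_frac_def c_frac_def
  by (auto intro!: mult_pos_pos divide_pos_pos Gamma_real_pos)

lemma kern_measurable1 [measurable]: "kern H n x \<in> borel_measurable borel"
  unfolding kern_def by measurable

lemma kern_integral_measurable [measurable]: "kern_integral H n \<in> borel_measurable borel"
  unfolding kern_integral_def kern_def set_lebesgue_integral_def by measurable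

lemma kern_nonneg: "0 \<le> kern H n x v"
  by (simp add: kern_def)

lemma powr_neg_antimono: "0 < x \<Longrightarrow> x \<le> y \<Longrightarrow> p \<le> 0 \<Longrightarrow> y powr p \<le> (x::real) powr p"
  using powr_mono2'[of p x y] by simp

text \<open>
  For \<open>x \<le> n - 1\<close> the time lag \<open>v + n - 1 - x\<close> is at least \<open>v\<close>, so the singularity of the
  kernel is at worst that of \<open>v powr (H - 3/2)\<close> at 0.
\<close>
lemma kern_integrable:
  assumes H: "1/2 < H" "H < 1" and "1 \<le> n" "x \<le> real n - 1"
  shows "set_integrable lborel {0..1} (kern H n x)"
    and "kern_integral H n x \<le> real n powr (H - 1/2) / (H - 1/2)"
proof -
  have bd: "AE v in lborel. v \<in> {0..1} \<longrightarrow> kern H n x v \<le> real n powr (H - 1/2) * v powr (H - 3/2)"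
    using AE_lborel_singleton[of 0]
  proof eventually_elim
    fix v :: real assume v: "v \<noteq> 0"
    show "v \<in> {0..1} \<longrightarrow> kern H n x v \<le> real n powr (H - 1/2) * v powr (H - 3/2)"
    proof
      assume "v \<in> {0..1}"
      with v have v: "0 < v" "v \<le> 1" by auto
      show "kern H n x v \<le> real n powr (H - 1/2) * v powr (H - 3/2)"
        unfolding kern_def
      proof (rule mult_mono)
        show "(v + real n - 1) powr (H - 1/2) \<le> real n powr (H - 1/2)"
          using v assms by (intro powr_mono2) auto
        show "(v + real n - 1 - x) powr (H - 3/2) \<le> v powr (H - 3/2)"
          using v assms by (intro powr_neg_antimono) auto
      qed auto
    qed
  qed
  have si: "set_integrable lborel {0..1} (\<lambda>v. real n powr (H - 1/2) * v powr (H - 3/2))"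
    using set_integrable_powr_unit(1)[of "H - 3/2"] H by simp
  show *: "set_integrable lborel {0..1} (kern H n x)"
  proof (rule set_integrable_bound[OF si])
    show "set_borel_measurable lborel {0..1} (kern H n x)"
      unfolding set_borel_measurable_def by measurable
    show "AE v in lborel. v \<in> {0..1} \<longrightarrow> norm (kern H n x v) \<le> norm (real n powr (H - 1/2) * v powr (H - 3/2))"
      using bd by eventually_elim (simp add: kern_nonneg)
  qed
  have "kern_integral H n x \<le> (LBINT v:{0..1}. real n powr (H - 1/2) * v powr (H - 3/2))"
    unfolding kern_integral_def using bd by (intro set_integral_mono_AE * si) auto
  also have "\<dots> = real n powr (H - 1/2) / (H - 1/2)"
    using set_integrable_powr_unit(2)[of "H - 3/2"] H by simp
  finally show "kern_integral H n x \<le> real n powr (H - 1/2) / (H - 1/2)" .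
qed

lemma kern_integral_nonneg: "0 \<le> kern_integral H n x"
  unfolding kern_integral_def by (simp add: set_integral_nonneg kern_nonneg)

lemma coef_j_integrand_integrable:
  assumes H: "1/2 < H" "H < 1" and "1 \<le> i" "i < n"
  shows "set_integrable lborel {real i - 1..real i} (\<lambda>x. x powr (1/2 - H) * kern_integral H n x)"
proof -
  define c where "c = real n powr (H - 1/2) / (H - 1/2)"
  have c0: "0 \<le> c" using H by (simp add: c_def)
  have si: "set_integrable lborel {real i - 1..real i} (\<lambda>x. c * (x - (real i - 1)) powr (1/2 - H))"
    using set_integrable_powr_cell(1)[of "1/2 - H" i] assms by simp
  show ?thesis
  proof (rule set_integrable_bound[OF si])
    show "set_borel_measurable lborel {real i - 1..real i} (\<lambda>x. x powr (1/2 - H) * kern_integral H n x)"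
      unfolding set_borel_measurable_def by measurable
    show "AE x in lborel. x \<in> {real i - 1..real i} \<longrightarrow> norm (x powr (1/2 - H) * kern_integral H n x)
        \<le> norm (c * (x - (real i - 1)) powr (1/2 - H))"
      using AE_lborel_singleton[of "real i - 1"]
    proof eventually_elim
      fix x :: real assume x: "x \<noteq> real i - 1"
      show "x \<in> {real i - 1..real i} \<longrightarrow> norm (x powr (1/2 - H) * kern_integral H n x)
        \<le> norm (c * (x - (real i - 1)) powr (1/2 - H))"
      proof
        assume xi: "x \<in> {real i - 1..real i}"
        have "kern_integral H n x \<le> c"
          unfolding c_def using assms xi by (intro kern_integrable(2)) auto
        moreover have "x powr (1/2 - H) \<le> (x - (real i - 1)) powr (1/2 - H)"
          using x xi assms by (intro powr_neg_antimono) auto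
        ultimately have "kern_integral H n x * x powr (1/2 - H) \<le> c * (x - (real i - 1)) powr (1/2 - H)"
          using c0 by (intro mult_mono) (auto simp: kern_integral_nonneg)
        then show "norm (x powr (1/2 - H) * kern_integral H n x) \<le> norm (c * (x - (real i - 1)) powr (1/2 - H))"
          using c0 kern_integral_nonneg[of H n x] by (simp add: abs_mult mult.commute)
      qed
    qed
  qed
qed

lemma coef_j_nonneg:
  assumes "1/2 < H" "H < 1" "0 < \<sigma>" shows "0 \<le> coef_j H \<sigma> n i"
  unfolding coef_j_eq using assms C_frac_pos[of H]
  by (auto intro!: mult_nonneg_nonneg set_integral_nonneg kern_integral_nonneg)

lemma cell_scale:
  assumes "1 \<le> (i::nat)" "real i - 1 < x" "x \<le> real i"
  shows "real i * (x - (real i - 1)) \<le> x"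
proof -
  have "0 \<le> (real i - 1) * (1 - (x - (real i - 1)))" using assms by (intro mult_nonneg_nonneg) auto
  then show ?thesis by (simp add: algebra_simps)
qed

text \<open>
  On the cell from \<open>i - 1\<close> to \<open>i\<close> the decay in \<open>i\<close> factors out, and what remains is the same
  integrable singularity on every cell, the first one included.
\<close>
lemma cell_powr_le:
  assumes "1 \<le> (i::nat)" "real i - 1 < x" "x \<le> real i" "p \<le> 0"
  shows "x powr p \<le> real i powr p * (x - (real i - 1)) powr p"
proof -
  have "x powr p \<le> (real i * (x - (real i - 1))) powr p"
    using assms cell_scale[OF assms(1-3)] by (intro powr_neg_antimono) auto
  then show ?thesis using assms by (simp add: powr_mult)
qed

text \<open>
  The two singularities, at \<open>x = 0\<close> and at \<open>x = t\<close>, lie on different sides of \<open>t / 2\<close>.  On each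
  side the other factor is comparable to its value there, and the exponents of the three factors
  add up to \<open>H - 3/2\<close>.  The square of this power has exponent \<open>2 * H - 3 < -1\<close>, which is why
  the coefficients turn out to be square summable.
\<close>
lemma kernel_split:
  assumes H: "1/2 < H" "H < 1" and "0 < x" "x < (t::real)"
  shows "x powr (1/2 - H) * (t powr (H - 1/2) * (t - x) powr (H - 3/2))
           \<le> 2 * ((t - x) powr (H - 3/2) + x powr (H - 3/2))"
proof (cases "t - x \<le> x")
  case True
  have "t powr (H - 1/2) \<le> (2 * x) powr (H - 1/2)" using assms True by (intro powr_mono2) auto
  also have "\<dots> = 2 powr (H - 1/2) * x powr (H - 1/2)" using assms by (simp add: powr_mult)
  also have "\<dots> \<le> 2 * x powr (H - 1/2)"
    using powr_mono[of "H - 1/2" 1 2] H by (intro mult_right_mono) auto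
  finally have "x powr (1/2 - H) * t powr (H - 1/2) \<le> x powr (1/2 - H) * (2 * x powr (H - 1/2))"
    by (intro mult_left_mono) auto
  also have "\<dots> = 2" using assms by (simp add: powr_add[symmetric])
  finally have "(x powr (1/2 - H) * t powr (H - 1/2)) * (t - x) powr (H - 3/2) \<le> 2 * (t - x) powr (H - 3/2)"
    by (intro mult_right_mono) auto
  then show ?thesis by (simp add: mult.assoc add_increasing2)
next
  case False
  have "t powr (H - 1/2) \<le> (2 * (t - x)) powr (H - 1/2)" using assms False by (intro powr_mono2) auto
  also have "\<dots> = 2 powr (H - 1/2) * (t - x) powr (H - 1/2)" by (rule powr_mult)
  also have "\<dots> \<le> 2 * (t - x) powr (H - 1/2)"
    using powr_mono[of "H - 1/2" 1 2] H by (intro mult_right_mono) auto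
  finally have "t powr (H - 1/2) * (t - x) powr (H - 3/2) \<le> (2 * (t - x) powr (H - 1/2)) * (t - x) powr (H - 3/2)"
    by (intro mult_right_mono) auto
  also have "\<dots> = 2 * (t - x) powr (2 * H - 2)" using assms by (simp add: powr_add[symmetric])
  also have "\<dots> \<le> 2 * x powr (2 * H - 2)"
    using assms False by (intro mult_left_mono powr_neg_antimono) auto
  finally have "x powr (1/2 - H) * (t powr (H - 1/2) * (t - x) powr (H - 3/2)) \<le> x powr (1/2 - H) * (2 * x powr (2 * H - 2))"
    by (intro mult_left_mono) auto
  also have "\<dots> = 2 * x powr (H - 3/2)" using assms by (simp add: powr_add[symmetric])
  finally show ?thesis by (simp add: add_increasing)
qed

lemma coef_j_integrand_le:
  assumes H: "1/2 < H" "H < 1" and i: "1 \<le> i" "i < n" and x: "real i - 1 < x" "x < real i"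
  shows "x powr (1/2 - H) * kern_integral H n x
     \<le> 2 * (real (n - i) powr (H - 3/2) / (H - 1/2) + x powr (H - 3/2))"
proof -
  let ?d = "real (n - i)"
  have d: "?d = real n - real i" using i by (simp add: of_nat_diff)
  have x0: "0 < x" using i x by linarith
  have bd: "AE v in lborel. v \<in> {0..1} \<longrightarrow> x powr (1/2 - H) * kern H n x v
      \<le> 2 * (?d powr (H - 3/2)) * v powr (H - 3/2) + 2 * x powr (H - 3/2)"
    using AE_lborel_singleton[of 0]
  proof eventually_elim
    fix v :: real assume v: "v \<noteq> 0"
    show "v \<in> {0..1} \<longrightarrow> x powr (1/2 - H) * kern H n x v
      \<le> 2 * (?d powr (H - 3/2)) * v powr (H - 3/2) + 2 * x powr (H - 3/2)"
    proof
      assume "v \<in> {0..1}"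
      with v have v: "0 < v" "v \<le> 1" by auto
      let ?y = "v + ?d - 1"
      have n: "real i + 1 \<le> real n" using i by linarith
      have "(v + real n - 1 - x) powr (H - 3/2) \<le> ?y powr (H - 3/2)"
        using v x d n H by (intro powr_neg_antimono) auto
      also have "\<dots> \<le> ?d powr (H - 3/2) * (?y - (?d - 1)) powr (H - 3/2)"
        using v i H by (intro cell_powr_le) auto
      finally have "(v + real n - 1 - x) powr (H - 3/2) \<le> ?d powr (H - 3/2) * v powr (H - 3/2)"
        by (simp add: algebra_simps)
      moreover have "x powr (1/2 - H) * kern H n x v
          \<le> 2 * ((v + real n - 1 - x) powr (H - 3/2) + x powr (H - 3/2))"
        unfolding kern_def using v x n x0 by (intro kernel_split H) auto
      ultimately show "x powr (1/2 - H) * kern H n x v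
      \<le> 2 * (?d powr (H - 3/2)) * v powr (H - 3/2) + 2 * x powr (H - 3/2)" by simp
    qed
  qed
  have ik: "set_integrable lborel {0..1} (kern H n x)"
    using i x H by (intro kern_integrable) auto
  have sp: "set_integrable lborel {0..1} (\<lambda>v::real. v powr (H - 3/2))"
    using H by (intro set_integrable_powr_unit) auto
  have "x powr (1/2 - H) * kern_integral H n x = (LBINT v:{0..1}. x powr (1/2 - H) * kern H n x v)"
    by (simp add: kern_integral_def)
  also have "\<dots> \<le> (LBINT v:{0..1}. 2 * (?d powr (H - 3/2)) * v powr (H - 3/2) + 2 * x powr (H - 3/2))"
    using bd ik sp by (intro set_integral_mono_AE set_integral_add set_integrable_mult_right set_integral_const_unit_interval) auto
  also have "\<dots> = 2 * (?d powr (H - 3/2)) / (H - 1/2) + 2 * x powr (H - 3/2)"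
    using sp set_integrable_powr_unit(2)[of "H - 3/2"] H
    by (subst set_integral_add(2)) (auto intro!: set_integrable_mult_right set_integral_const_unit_interval simp: set_integral_const_unit_interval)
  finally show ?thesis by (simp add: algebra_simps)
qed

lemma coef_j_le:
  assumes H: "1/2 < H" "H < 1" and s: "0 < \<sigma>" and i: "1 \<le> i" "i < n"
  shows "coef_j H \<sigma> n i \<le> (\<sigma> * C_frac H * 2 / (H - 1/2)) *
           (real (n - i) powr (H - 3/2) + real i powr (H - 3/2))"
proof -
  let ?d = "real (n - i) powr (H - 3/2)" and ?e = "real i powr (H - 3/2)"
  have sp: "set_integrable lborel {real i - 1..real i} (\<lambda>x. (x - (real i - 1)) powr (H - 3/2))"
    using H i by (intro set_integrable_powr_cell) auto
  have bd: "AE x in lborel. x \<in> {real i - 1..real i} \<longrightarrow> x powr (1/2 - H) * kern_integral H n x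
     \<le> 2 * ?d / (H - 1/2) + 2 * ?e * (x - (real i - 1)) powr (H - 3/2)"
    using AE_lborel_singleton[of "real i - 1"] AE_lborel_singleton[of "real i"]
  proof eventually_elim
    fix x assume x: "x \<noteq> real i - 1" "x \<noteq> real i"
    show "x \<in> {real i - 1..real i} \<longrightarrow> x powr (1/2 - H) * kern_integral H n x
     \<le> 2 * ?d / (H - 1/2) + 2 * ?e * (x - (real i - 1)) powr (H - 3/2)"
      using coef_j_integrand_le[OF H i, of x] cell_powr_le[OF i(1), of x "H - 3/2"] x H by auto
  qed
  have "(LBINT x:{real i - 1..real i}. x powr (1/2 - H) * kern_integral H n x)
     \<le> (LBINT x:{real i - 1..real i}. 2 * ?d / (H - 1/2) + 2 * ?e * (x - (real i - 1)) powr (H - 3/2))"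
    using bd sp coef_j_integrand_integrable[OF H i]
    by (intro set_integral_mono_AE set_integral_add set_integrable_mult_right set_integral_const_unit_interval) auto
  also have "\<dots> = 2 * ?d / (H - 1/2) + 2 * ?e / (H - 1/2)"
    using sp set_integrable_powr_cell(2)[of "H - 3/2" i] H i
    by (subst set_integral_add(2)) (auto intro!: set_integrable_mult_right set_integral_const_unit_interval simp: set_integral_const_unit_interval)
  finally have "(\<sigma> * C_frac H) * (LBINT x:{real i - 1..real i}. x powr (1/2 - H) * kern_integral H n x)
     \<le> (\<sigma> * C_frac H) * (2 * ?d / (H - 1/2) + 2 * ?e / (H - 1/2))"
    using s C_frac_pos[OF H] by (intro mult_left_mono) auto
  then show ?thesis unfolding coef_j_eq by (simp add: algebra_simps add_divide_distrib)
qed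

text \<open>
  For the two most recent signs the time lag is at most 3, and the factor \<open>(t / x) powr (H - 1/2)\<close>
  of the kernel is at least 1.
\<close>
lemma coef_j_ge:
  assumes H: "1/2 < H" "H < 1" and s: "0 < \<sigma>" and i: "1 \<le> i" "i < n" "n \<le> i + 2"
  shows "\<sigma> * C_frac H * 3 powr (H - 3/2) \<le> coef_j H \<sigma> n i"
proof -
  have ker: "3 powr (H - 3/2) \<le> x powr (1/2 - H) * kern H n x v"
    if x: "real i - 1 < x" "x < real i" and v: "0 < v" "v \<le> 1" for x v
  proof -
    have n: "real i + 1 \<le> real n" "real n \<le> real i + 2" using i by linarith+
    have x0: "0 < x" using i x by linarith
    have "1 = x powr (1/2 - H) * x powr (H - 1/2)" using x0 by (simp add: powr_add[symmetric])
    also have "\<dots> \<le> x powr (1/2 - H) * (v + real n - 1) powr (H - 1/2)"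
      using x0 n v x H by (intro mult_left_mono powr_mono2) auto
    finally have 1: "1 \<le> x powr (1/2 - H) * (v + real n - 1) powr (H - 1/2)" .
    have 2: "3 powr (H - 3/2) \<le> (v + real n - 1 - x) powr (H - 3/2)"
      using x0 n v x H by (intro powr_neg_antimono) auto
    show ?thesis using mult_mono[OF 1 2] by (simp add: kern_def mult.assoc)
  qed
  have inn: "3 powr (H - 3/2) \<le> x powr (1/2 - H) * kern_integral H n x" if x: "real i - 1 < x" "x < real i" for x
  proof -
    have "3 powr (H - 3/2) = (LBINT v:{0..1::real}. 3 powr (H - 3/2))"
      by (simp add: set_integral_const_unit_interval)
    also have "\<dots> \<le> (LBINT v:{0..1}. x powr (1/2 - H) * kern H n x v)"
    proof (rule set_integral_mono_AE)
      show "set_integrable lborel {0..1} (\<lambda>v. x powr (1/2 - H) * kern H n x v)"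
        using i x H by (intro set_integrable_mult_right kern_integrable) auto
      show "AE v\<in>{0..1} in lborel. 3 powr (H - 3/2) \<le> x powr (1/2 - H) * kern H n x v"
        using AE_lborel_singleton[of 0]
      proof eventually_elim
        fix v :: real assume "v \<noteq> 0"
        then show "v \<in> {0..1} \<longrightarrow> 3 powr (H - 3/2) \<le> x powr (1/2 - H) * kern H n x v"
          using ker[OF x, of v] by auto
      qed
    qed (rule set_integral_const_unit_interval)
    finally show ?thesis by (simp add: kern_integral_def)
  qed
  have "3 powr (H - 3/2) = (LBINT x:{real i - 1..real i}. 3 powr (H - 3/2))"
    by (simp add: set_integral_const_unit_interval)
  also have "\<dots> \<le> (LBINT x:{real i - 1..real i}. x powr (1/2 - H) * kern_integral H n x)"
  proof (rule set_integral_mono_AE)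
    show "AE x\<in>{real i - 1..real i} in lborel. 3 powr (H - 3/2) \<le> x powr (1/2 - H) * kern_integral H n x"
      using AE_lborel_singleton[of "real i - 1"] AE_lborel_singleton[of "real i"]
    proof eventually_elim
      fix x assume "x \<noteq> real i - 1" "x \<noteq> real i"
      then show "x \<in> {real i - 1..real i} \<longrightarrow> 3 powr (H - 3/2) \<le> x powr (1/2 - H) * kern_integral H n x"
        using inn[of x] by auto
    qed
  qed (use coef_j_integrand_integrable[OF H i(1,2)] set_integral_const_unit_interval in auto)
  finally show ?thesis
    unfolding coef_j_eq using s C_frac_pos[OF H] by (intro mult_left_mono) auto
qed

text \<open>
  Both powers have exponents of modulus at most 1, so moving their bases by 1 changes them by a
  relative amount of at most \<open>1 / s\<close> and \<open>1 / u\<close>; they move in opposite directions, hence the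
  changes do not add up.
\<close>
lemma shifted_kernel_diff:
  fixes s u a b :: real
  assumes "0 < u" "u \<le> s" "0 \<le> a" "a \<le> 1" "0 \<le> b" "b \<le> 1"
  shows "\<bar>(s + 1) powr a * (u + 1) powr (-b) - s powr a * u powr (-b)\<bar> \<le> s powr a * u powr (-b) / u"
proof -
  have s: "0 < s" using assms by simp
  have "(s + 1) powr a = (s * (1 + 1/s)) powr a" using s by (simp add: distrib_left)
  also have "\<dots> = s powr a * (1 + 1/s) powr a" by (rule powr_mult)
  also have "\<dots> \<le> s powr a * (1 + 1/s)"
    using powr_mono[of a 1 "1 + 1/s"] assms s by (intro mult_left_mono) auto
  also have "\<dots> \<le> s powr a * (1 + 1/u)"
    using assms s by (intro mult_left_mono) (auto simp: frac_le)
  finally have 1: "(s + 1) powr a \<le> s powr a * (1 + 1/u)" .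
  have 2: "(u + 1) powr (-b) \<le> u powr (-b)" using assms by (intro powr_neg_antimono) auto
  have up: "(s + 1) powr a * (u + 1) powr (-b) \<le> s powr a * (1 + 1/u) * u powr (-b)"
    using 1 2 assms by (intro mult_mono) auto
  have "1 - 1/u \<le> u / (u + 1)" using assms by (simp add: field_simps)
  also have "\<dots> \<le> (u / (u + 1)) powr b" using powr_mono'[of b 1 "u / (u+1)"] assms by auto
  finally have "u powr (-b) * (1 - 1/u) \<le> u powr (-b) * (u / (u + 1)) powr b"
    by (intro mult_left_mono) auto
  also have "\<dots> = (u + 1) powr (-b)" using assms by (simp add: powr_divide powr_minus field_simps)
  finally have 3: "u powr (-b) * (1 - 1/u) \<le> (u + 1) powr (-b)" .
  have 4: "s powr a \<le> (s + 1) powr a" using assms by (intro powr_mono2) auto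
  have "s powr a * (u powr (-b) * (1 - 1/u)) \<le> s powr a * (u + 1) powr (-b)"
    using 3 by (intro mult_left_mono) auto
  also have "\<dots> \<le> (s + 1) powr a * (u + 1) powr (-b)" using 4 by (intro mult_right_mono) auto
  finally show ?thesis using up by (simp add: algebra_simps abs_le_iff)
qed

text \<open>
  The pointwise relative bound \<open>1 / u\<close> on the change of the kernel, with \<open>u \<ge> n - 2 - i\<close>, passes
  through both integrals because the kernel is nonnegative.
\<close>
lemma coef_j_diff:
  assumes H: "1/2 < H" "H < 1" and s: "0 < \<sigma>" and i: "1 \<le> i" "i + 3 \<le> n"
  shows "\<bar>coef_j H \<sigma> n i - coef_j H \<sigma> (n - 1) i\<bar> \<le> coef_j H \<sigma> (n - 1) i / real (n - 2 - i)"
proof -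
  let ?c = "1 / real (n - 2 - i)"
  have n: "real i + 3 \<le> real n" using i by linarith
  have d: "real (n - 2 - i) = real n - 2 - real i" "real (n - 1) = real n - 1" using i by (auto simp: of_nat_diff)
  have ker: "\<bar>kern H n x v - kern H (n - 1) x v\<bar> \<le> ?c * kern H (n - 1) x v"
    if x: "0 \<le> x" "x \<le> real i" and v: "0 \<le> v" for x v
  proof -
    define u where "u = v + real (n - 1) - 1 - x"
    have u: "real (n - 2 - i) \<le> u" "0 < u" "u \<le> v + real (n - 1) - 1" using x v n d by (auto simp: u_def)
    have "\<bar>kern H n x v - kern H (n - 1) x v\<bar> \<le> kern H (n - 1) x v / u"
      using shifted_kernel_diff[of u "v + real (n - 1) - 1" "H - 1/2" "3/2 - H"] u H
      by (simp add: kern_def u_def d(2) algebra_simps del: One_nat_def of_nat_diff)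
    also have "\<dots> \<le> kern H (n - 1) x v / real (n - 2 - i)"
      using u kern_nonneg i d n by (intro divide_left_mono mult_pos_pos) auto
    finally show ?thesis by simp
  qed
  have inn: "\<bar>kern_integral H n x - kern_integral H (n - 1) x\<bar> \<le> ?c * kern_integral H (n - 1) x"
    if x: "0 \<le> x" "x \<le> real i" for x
  proof -
    have k: "set_integrable lborel {0..1} (kern H n x)" "set_integrable lborel {0..1} (kern H (n - 1) x)"
      using x n d H i by (auto intro!: kern_integrable)
    have "\<bar>kern_integral H n x - kern_integral H (n - 1) x\<bar> = \<bar>LBINT v:{0..1}. kern H n x v - kern H (n - 1) x v\<bar>"
      unfolding kern_integral_def using k by (simp add: set_integral_diff)
    also have "\<dots> \<le> (LBINT v:{0..1}. \<bar>kern H n x v - kern H (n - 1) x v\<bar>)"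
      using set_integral_norm_bound[OF set_integral_diff(1)[OF k]] by simp
    also have "\<dots> \<le> (LBINT v:{0..1}. ?c * kern H (n - 1) x v)"
      using k ker[OF x] by (intro set_integral_mono set_integrable_abs set_integral_diff set_integrable_mult_right) auto
    finally show ?thesis by (simp add: kern_integral_def)
  qed
  let ?h = "\<lambda>n x. x powr (1/2 - H) * kern_integral H n x"
  let ?A = "{real i - 1..real i}"
  have k: "set_integrable lborel ?A (?h n)" "set_integrable lborel ?A (?h (n - 1))"
    using i H by (auto intro!: coef_j_integrand_integrable)
  have pt: "\<bar>?h n x - ?h (n - 1) x\<bar> \<le> ?c * ?h (n - 1) x" if "x \<in> ?A" for x
  proof -
    have "\<bar>?h n x - ?h (n - 1) x\<bar> = x powr (1/2 - H) * \<bar>kern_integral H n x - kern_integral H (n - 1) x\<bar>"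
      by (simp add: right_diff_distrib[symmetric] abs_mult)
    also have "\<dots> \<le> x powr (1/2 - H) * (?c * kern_integral H (n - 1) x)"
      using that i by (intro mult_left_mono inn) auto
    finally show ?thesis by (simp add: mult_ac)
  qed
  have "\<bar>(LBINT x:?A. ?h n x) - (LBINT x:?A. ?h (n - 1) x)\<bar> = \<bar>LBINT x:?A. ?h n x - ?h (n - 1) x\<bar>"
    using k by (simp add: set_integral_diff)
  also have "\<dots> \<le> (LBINT x:?A. \<bar>?h n x - ?h (n - 1) x\<bar>)"
    using set_integral_norm_bound[OF set_integral_diff(1)[OF k]] by simp
  also have "\<dots> \<le> (LBINT x:?A. ?c * ?h (n - 1) x)"
    using k pt by (intro set_integral_mono set_integrable_abs set_integral_diff set_integrable_mult_right) auto
  also have "\<dots> = ?c * (LBINT x:?A. ?h (n - 1) x)" by (simp del: times_divide_eq_left)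
  finally have "(\<sigma> * C_frac H) * \<bar>(LBINT x:?A. ?h n x) - (LBINT x:?A. ?h (n - 1) x)\<bar>
     \<le> (\<sigma> * C_frac H) * (?c * (LBINT x:?A. ?h (n - 1) x))"
    using s C_frac_pos[OF H] by (intro mult_left_mono) auto
  moreover have "\<bar>coef_j H \<sigma> n i - coef_j H \<sigma> (n - 1) i\<bar>
      = (\<sigma> * C_frac H) * \<bar>(LBINT x:?A. ?h n x) - (LBINT x:?A. ?h (n - 1) x)\<bar>"
    unfolding coef_j_eq using s C_frac_pos[OF H] by (simp add: right_diff_distrib[symmetric] abs_mult)
  ultimately show ?thesis by (simp add: coef_j_eq)
qed

lemma coef_g_bounds:
  assumes H: "1/2 < H" "H < 1" and s: "0 < \<sigma>" and n: "1 \<le> n"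
  shows "0 \<le> coef_g H \<sigma> n" and "coef_g H \<sigma> n \<le> \<sigma> * C_frac H / ((H - 1/2) * (3/2 - H))"
proof -
  let ?inn = "\<lambda>x. (LBINT y:{0..1}. (y * (real n - x) + x) powr (H - 1/2) * y powr (H - 3/2))"
  let ?A = "{real n - 1..real n}"
  have nn: "0 \<le> ?inn x" for x by (auto intro!: set_integral_nonneg)
  have sC: "0 < \<sigma> * C_frac H" using s C_frac_pos[OF H] by simp
  show "0 \<le> coef_g H \<sigma> n"
    unfolding coef_g_def using s C_frac_pos[OF H] nn
    by (intro mult_nonneg_nonneg set_integral_nonneg) auto
  have inn: "?inn x \<le> real n powr (H - 1/2) / (H - 1/2)" if x: "x \<in> ?A" for x
  proof -
    have sp: "set_integrable lborel {0..1} (\<lambda>y::real. y powr (H - 3/2))"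
      using H by (intro set_integrable_powr_unit) auto
    have "?inn x \<le> (LBINT y:{0..1}. real n powr (H - 1/2) * y powr (H - 3/2))"
      unfolding set_lebesgue_integral_def
    proof (rule integral_mono')
      show "integrable lborel (\<lambda>y. indicator {0..1} y *\<^sub>R (real n powr (H - 1/2) * y powr (H - 3/2)))"
        using set_integrable_mult_right[OF sp, of "real n powr (H - 1/2)"] by (simp add: set_integrable_def)
      fix y :: real
      have "(y * (real n - x) + x) powr (H - 1/2) \<le> real n powr (H - 1/2)" if "y \<in> {0..1}"
      proof (rule powr_mono2)
        have "y * (real n - x) \<le> 1 * (real n - x)" using that x by (intro mult_right_mono) auto
        then show "y * (real n - x) + x \<le> real n" by simp
      qed (use that x n H in auto)
      then show "indicator {0..1} y *\<^sub>R ((y * (real n - x) + x) powr (H - 1/2) * y powr (H - 3/2))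
          \<le> indicator {0..1} y *\<^sub>R (real n powr (H - 1/2) * y powr (H - 3/2))"
        by (auto simp: indicator_def intro!: mult_right_mono)
    qed (auto simp: indicator_def)
    also have "\<dots> = real n powr (H - 1/2) / (H - 1/2)"
      using set_integrable_powr_unit(2)[of "H - 3/2"] H by simp
    finally show ?thesis .
  qed
  have sp: "set_integrable lborel ?A (\<lambda>x. (x - (real n - 1)) powr (1/2 - H))"
    using H n by (intro set_integrable_powr_cell) auto
  have "AE x in lborel. indicator ?A x *\<^sub>R (x powr (1/2 - H) * (real n - x) powr (H - 1/2) * ?inn x)
        \<le> indicator ?A x *\<^sub>R (1 / (H - 1/2) * (x - (real n - 1)) powr (1/2 - H))"
    using AE_lborel_singleton[of "real n - 1"]
  proof eventually_elim
    fix x assume x: "x \<noteq> real n - 1"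
    { assume A: "x \<in> ?A"
      have 1: "x powr (1/2 - H) \<le> real n powr (1/2 - H) * (x - (real n - 1)) powr (1/2 - H)"
        using A x n H by (intro cell_powr_le) auto
      have 2: "(real n - x) powr (H - 1/2) \<le> 1 powr (H - 1/2)"
        using A H by (intro powr_mono2) auto
      have "(x powr (1/2 - H) * (real n - x) powr (H - 1/2)) * ?inn x
        \<le> ((real n powr (1/2 - H) * (x - (real n - 1)) powr (1/2 - H)) * 1) * (real n powr (H - 1/2) / (H - 1/2))"
        using 1 2 inn[OF A] nn by (intro mult_mono mult_nonneg_nonneg) auto
      also have "\<dots> = (real n powr (1/2 - H) * real n powr (H - 1/2)) * (1 / (H - 1/2) * (x - (real n - 1)) powr (1/2 - H))"
        by simp
      also have "real n powr (1/2 - H) * real n powr (H - 1/2) = 1" using n by (simp add: powr_add[symmetric])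
      finally have "x powr (1/2 - H) * (real n - x) powr (H - 1/2) * ?inn x
        \<le> 1 / (H - 1/2) * (x - (real n - 1)) powr (1/2 - H)" by simp }
    then show "indicator ?A x *\<^sub>R (x powr (1/2 - H) * (real n - x) powr (H - 1/2) * ?inn x)
        \<le> indicator ?A x *\<^sub>R (1 / (H - 1/2) * (x - (real n - 1)) powr (1/2 - H))"
      by (auto simp: indicator_def)
  qed
  then have "(LBINT x:?A. x powr (1/2 - H) * (real n - x) powr (H - 1/2) * ?inn x)
     \<le> (LBINT x:?A. 1 / (H - 1/2) * (x - (real n - 1)) powr (1/2 - H))"
    unfolding set_lebesgue_integral_def
  proof (rule integral_mono_AE'[rotated])
    show "integrable lborel (\<lambda>x. indicator ?A x *\<^sub>R (1 / (H - 1/2) * (x - (real n - 1)) powr (1/2 - H)))"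
      using set_integrable_mult_right[OF sp, of "1 / (H - 1/2)"] by (simp add: set_integrable_def)
    show "AE x in lborel. 0 \<le> indicator ?A x *\<^sub>R (1 / (H - 1/2) * (x - (real n - 1)) powr (1/2 - H))"
      using H by (auto simp: indicator_def)
  qed
  also have "\<dots> = 1 / ((H - 1/2) * (3/2 - H))"
    using set_integrable_powr_cell(2)[of "1/2 - H" n] H n by simp
  finally have "\<sigma> * C_frac H * (LBINT x:?A. x powr (1/2 - H) * (real n - x) powr (H - 1/2) * ?inn x)
     \<le> \<sigma> * C_frac H * (1 / ((H - 1/2) * (3/2 - H)))"
    using sC by (intro mult_left_mono) auto
  then show "coef_g H \<sigma> n \<le> \<sigma> * C_frac H / ((H - 1/2) * (3/2 - H))"
    unfolding coef_g_def by simp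
qed

lemma coef_j_square_sum_bounded:
  assumes H: "1/2 < H" "H < 1" and s: "0 < \<sigma>"
  obtains K where "0 < K" "\<And>n. (\<Sum>i\<in>{1..<n}. (coef_j H \<sigma> n i)\<^sup>2) \<le> K"
proof -
  define c where "c = \<sigma> * C_frac H * 2 / (H - 1/2)"
  have c: "0 < c" using s C_frac_pos[OF H] H by (simp add: c_def)
  let ?f = "\<lambda>i. real i powr (2 * H - 3)"
  have sf: "summable ?f" using H by (subst summable_real_powr_iff) auto
  have le: "(\<Sum>i\<in>{1..<n}. ?f i) \<le> suminf ?f" for n
    using sf by (intro sum_le_suminf) auto
  have rev: "(\<Sum>i\<in>{1..<n}. ?f (n - i)) = (\<Sum>i\<in>{1..<n}. ?f i)" for n
    by (rule sum.reindex_bij_witness[of _ "\<lambda>i. n - i" "\<lambda>i. n - i"]) auto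
  have pt: "(coef_j H \<sigma> n i)\<^sup>2 \<le> 2 * c\<^sup>2 * (?f (n - i) + ?f i)" if "i \<in> {1..<n}" for n i
  proof -
    let ?d = "real (n - i) powr (H - 3/2)" and ?e = "real i powr (H - 3/2)"
    have sq: "(real k powr (H - 3/2))\<^sup>2 = ?f k" for k
      by (simp add: power2_eq_square powr_add[symmetric])
    have "coef_j H \<sigma> n i \<le> c * (?d + ?e)"
      unfolding c_def using that by (intro coef_j_le assms) auto
    then have "(coef_j H \<sigma> n i)\<^sup>2 \<le> (c * (?d + ?e))\<^sup>2"
      using coef_j_nonneg[OF H s] by (intro power_mono) auto
    also have "\<dots> = c\<^sup>2 * (?d + ?e)\<^sup>2" by (simp add: power_mult_distrib)
    also have "\<dots> \<le> c\<^sup>2 * (2 * ?d\<^sup>2 + 2 * ?e\<^sup>2)"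
      using zero_le_power2[of "?d - ?e"] by (intro mult_left_mono) (auto simp: power2_eq_square algebra_simps)
    also have "\<dots> = 2 * c\<^sup>2 * (?f (n - i) + ?f i)" unfolding sq by (simp add: algebra_simps)
    finally show ?thesis .
  qed
  have nn: "0 \<le> suminf ?f" using sf by (intro suminf_nonneg) auto
  have "(\<Sum>i\<in>{1..<n}. (coef_j H \<sigma> n i)\<^sup>2) \<le> 4 * c\<^sup>2 * suminf ?f + 1" for n
  proof -
    have "(\<Sum>i\<in>{1..<n}. (coef_j H \<sigma> n i)\<^sup>2) \<le> (\<Sum>i\<in>{1..<n}. 2 * c\<^sup>2 * (?f (n - i) + ?f i))"
      by (intro sum_mono pt)
    also have "\<dots> = 2 * c\<^sup>2 * (2 * (\<Sum>i\<in>{1..<n}. ?f i))"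
      unfolding sum_distrib_left[symmetric] sum.distrib rev by simp
    also have "\<dots> \<le> 2 * c\<^sup>2 * (2 * suminf ?f)" by (intro mult_left_mono le) auto
    finally show ?thesis by simp
  qed
  moreover have "0 < 4 * c\<^sup>2 * suminf ?f + 1" using nn by (simp add: add_nonneg_pos)
  ultimately show ?thesis by (rule that[rotated])
qed

text \<open>
  By the relative bound on increments and Cauchy-Schwarz, the sum is at most the norm of the
  coefficients times the square root of a tail of \<open>\<Sum>d. 1 / d\<^sup>2\<close>.
\<close>
lemma coef_j_remote_increments_small:
  assumes H: "1/2 < H" "H < 1" and s: "0 < \<sigma>" and \<delta>: "0 < \<delta>"
  obtains m where "2 \<le> m"
    "\<And>n. (\<Sum>i\<in>{1..<n-m}. \<bar>coef_j H \<sigma> n i - coef_j H \<sigma> (n - 1) i\<bar>) \<le> \<delta>"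
proof -
  obtain K where K: "0 < K" "\<And>n. (\<Sum>i\<in>{1..<n}. (coef_j H \<sigma> n i)\<^sup>2) \<le> K"
    using coef_j_square_sum_bounded[OF H s] by blast
  let ?f = "\<lambda>d. (1 / real d)\<^sup>2"
  have sf: "summable ?f"
    using inverse_power_summable[of 2, where 'a=real] by (simp add: power_one_over inverse_eq_divide)
  obtain N where N: "\<And>q. q \<ge> N \<Longrightarrow> norm (\<Sum>d. ?f (d + q)) < \<delta>\<^sup>2 / K"
    using suminf_exist_split[OF _ sf, of "\<delta>\<^sup>2 / K"] \<delta> K by auto
  \<comment> \<open>The lags \<open>n - 2 - i\<close> with \<open>i < n - m\<close> start at \<open>m - 1\<close>, beyond \<open>N\<close> and positive.\<close>
  define m where "m = N + 2"
  have "(\<Sum>i\<in>{1..<n-m}. \<bar>coef_j H \<sigma> n i - coef_j H \<sigma> (n - 1) i\<bar>) \<le> \<delta>" for n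
  proof -
    let ?I = "{1..<n-m}" and ?g = "\<lambda>d. ?f (d + (m - 1))"
    have "(\<Sum>i\<in>?I. ?f (n - 2 - i)) = (\<Sum>i\<in>?I. ?g (n - m - 1 - i))"
      by (intro sum.cong refl arg_cong[where f="?f"]) (auto simp: m_def)
    also have "\<dots> = sum ?g ((\<lambda>i. n - m - 1 - i) ` ?I)"
      by (subst sum.reindex) (auto simp: inj_on_def)
    also have "\<dots> \<le> suminf ?g"
      using summable_ignore_initial_segment[OF sf, of "m - 1"]
      by (intro sum_le_suminf) auto
    also have "\<dots> \<le> \<delta>\<^sup>2 / K" using N[of "m - 1"] by (simp add: m_def)
    finally have 1: "(\<Sum>i\<in>?I. ?f (n - 2 - i)) \<le> \<delta>\<^sup>2 / K" .
    have "(\<Sum>i\<in>?I. (coef_j H \<sigma> (n - 1) i)\<^sup>2) \<le> (\<Sum>i\<in>{1..<n - 1}. (coef_j H \<sigma> (n - 1) i)\<^sup>2)"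
      by (intro sum_mono2) (auto simp: m_def)
    also have "\<dots> \<le> K" by (rule K)
    finally have 2: "(\<Sum>i\<in>?I. (coef_j H \<sigma> (n - 1) i)\<^sup>2) \<le> K" .
    have "(\<Sum>i\<in>?I. \<bar>coef_j H \<sigma> n i - coef_j H \<sigma> (n - 1) i\<bar>)
        \<le> (\<Sum>i\<in>?I. coef_j H \<sigma> (n - 1) i * (1 / real (n - 2 - i)))"
    proof (rule sum_mono)
      fix i assume "i \<in> ?I"
      then have "1 \<le> i" "i + 3 \<le> n" by (auto simp: m_def)
      from coef_j_diff[OF H s this]
      show "\<bar>coef_j H \<sigma> n i - coef_j H \<sigma> (n - 1) i\<bar> \<le> coef_j H \<sigma> (n - 1) i * (1 / real (n - 2 - i))"
        by simp
    qed
    also have "\<dots> \<le> \<delta>"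
    proof (rule power2_le_imp_le)
      have "(\<Sum>i\<in>?I. coef_j H \<sigma> (n - 1) i * (1 / real (n - 2 - i)))\<^sup>2
        \<le> (\<Sum>i\<in>?I. (coef_j H \<sigma> (n - 1) i)\<^sup>2) * (\<Sum>i\<in>?I. ?f (n - 2 - i))"
        by (rule Cauchy_Schwarz_ineq_sum)
      also have "\<dots> \<le> K * (\<delta>\<^sup>2 / K)" using 1 2 K by (intro mult_mono sum_nonneg) auto
      also have "\<dots> = \<delta>\<^sup>2" using K by simp
      finally show "(\<Sum>i\<in>?I. coef_j H \<sigma> (n - 1) i * (1 / real (n - 2 - i)))\<^sup>2 \<le> \<delta>\<^sup>2" .
    qed (use \<delta> in simp)
    finally show ?thesis .
  qed
  then show ?thesis using that[of m] by (simp add: m_def)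
qed

section \<open>Martingale transforms of independent signs\<close>
locale rademacher = prob_space M for M :: "'a measure" +
  fixes \<xi> :: "nat \<Rightarrow> 'a \<Rightarrow> real"
  assumes indep: "indep_vars (\<lambda>_. borel) \<xi> {1..}"
    and AE_sign: "1 \<le> i \<Longrightarrow> AE \<omega> in M. \<xi> i \<omega> = 1 \<or> \<xi> i \<omega> = -1"
    and mean0: "1 \<le> i \<Longrightarrow> expectation (\<xi> i) = 0"
begin

abbreviation F :: "nat \<Rightarrow> 'a measure" where "F \<equiv> nat_filt M \<xi>"

lemma xi_measurable: "1 \<le> i \<Longrightarrow> \<xi> i \<in> borel_measurable M"
  using indep unfolding indep_vars_def by blast

lemma space_F [simp]: "space (F i) = space M"
  by (simp add: nat_filt_def space_measure_of_conv)

lemma sets_F: "sets (F i) = sigma_sets (space M) (\<Union>j\<in>{1..i}. {\<xi> j -` B \<inter> space M | B. B \<in> sets borel})"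
  unfolding nat_filt_def by (rule sets_measure_of) auto

lemma sets_F_mono: "i \<le> j \<Longrightarrow> sets (F i) \<subseteq> sets (F j)"
  unfolding sets_F by (intro sigma_sets_mono' UN_mono) auto

lemma sets_F_M: "sets (F i) \<subseteq> sets M"
  unfolding sets_F
proof (rule sets.sigma_sets_subset)
  show "(\<Union>j\<in>{1..i}. {\<xi> j -` B \<inter> space M | B. B \<in> sets borel}) \<subseteq> sets M"
    using xi_measurable by (auto intro: measurable_sets)
qed

lemma F_mono: "f \<in> borel_measurable (F i) \<Longrightarrow> i \<le> j \<Longrightarrow> f \<in> borel_measurable (F j)"
  using sets_F_mono[of i j] by (auto simp: measurable_def)

lemma F_M: "f \<in> borel_measurable (F i) \<Longrightarrow> f \<in> borel_measurable M"
  using sets_F_M[of i] by (auto simp: measurable_def)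

lemma xi_F: assumes "1 \<le> j" "j \<le> i" shows "\<xi> j \<in> borel_measurable (F i)"
proof (rule measurableI)
  fix B :: "real set" assume "B \<in> sets borel"
  then have "\<xi> j -` B \<inter> space M \<in> (\<Union>j\<in>{1..i}. {\<xi> j -` B \<inter> space M | B. B \<in> sets borel})"
    using assms by (intro UN_I[of j]) auto
  then show "\<xi> j -` B \<inter> space (F i) \<in> sets (F i)" unfolding sets_F by auto
qed auto

definition ess_bounded :: "('a \<Rightarrow> real) \<Rightarrow> bool" where
  "ess_bounded X \<longleftrightarrow> X \<in> borel_measurable M \<and> (\<exists>B. AE \<omega> in M. \<bar>X \<omega>\<bar> \<le> B)"

lemma ess_bounded_integrable: assumes "ess_bounded X" shows "integrable M X"
proof -
  from assms obtain B where "X \<in> borel_measurable M" "AE \<omega> in M. \<bar>X \<omega>\<bar> \<le> B" by (auto simp: ess_bounded_def)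
  then show ?thesis by (intro integrable_const_bound[of _ B]) auto
qed

lemma ess_bounded_measurable: "ess_bounded X \<Longrightarrow> X \<in> borel_measurable M" by (simp add: ess_bounded_def)

lemma ess_bounded_const: "ess_bounded (\<lambda>\<omega>. c)" by (auto simp: ess_bounded_def)

lemma ess_bounded_xi: assumes "1 \<le> i" shows "ess_bounded (\<xi> i)"
proof -
  have "AE \<omega> in M. \<bar>\<xi> i \<omega>\<bar> \<le> 1" using AE_sign[OF assms] by eventually_elim auto
  then show ?thesis using xi_measurable[OF assms] unfolding ess_bounded_def by auto
qed

lemma ess_bounded_add: assumes "ess_bounded X" "ess_bounded Y" shows "ess_bounded (\<lambda>\<omega>. X \<omega> + Y \<omega>)"
proof -
  from assms obtain A B where "AE \<omega> in M. \<bar>X \<omega>\<bar> \<le> A" "AE \<omega> in M. \<bar>Y \<omega>\<bar> \<le> B" by (auto simp: ess_bounded_def)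
  then have "AE \<omega> in M. \<bar>X \<omega> + Y \<omega>\<bar> \<le> A + B" by eventually_elim linarith
  then show ?thesis using assms unfolding ess_bounded_def by auto
qed

lemma ess_bounded_mult: assumes "ess_bounded X" "ess_bounded Y" shows "ess_bounded (\<lambda>\<omega>. X \<omega> * Y \<omega>)"
proof -
  from assms obtain A B where "AE \<omega> in M. \<bar>X \<omega>\<bar> \<le> A" "AE \<omega> in M. \<bar>Y \<omega>\<bar> \<le> B" by (auto simp: ess_bounded_def)
  then have "AE \<omega> in M. \<bar>X \<omega> * Y \<omega>\<bar> \<le> A * B"
    by eventually_elim (auto simp: abs_mult intro!: mult_mono)
  then show ?thesis using assms unfolding ess_bounded_def by auto
qed

lemma ess_bounded_sum: "(\<And>i. i \<in> I \<Longrightarrow> ess_bounded (X i)) \<Longrightarrow> ess_bounded (\<lambda>\<omega>. \<Sum>i\<in>I. X i \<omega>)"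
  by (induction I rule: infinite_finite_induct) (auto intro: ess_bounded_const ess_bounded_add)

lemma ess_bounded_power2: "ess_bounded X \<Longrightarrow> ess_bounded (\<lambda>\<omega>. (X \<omega>)\<^sup>2)"
  using ess_bounded_mult[of X X] by (simp add: power2_eq_square)

lemma ess_bounded_restrict:
  assumes "ess_bounded X" "Measurable.pred M P" shows "ess_bounded (\<lambda>\<omega>. if P \<omega> then X \<omega> else 0)"
proof -
  from assms obtain A where "AE \<omega> in M. \<bar>X \<omega>\<bar> \<le> A" by (auto simp: ess_bounded_def)
  then have "AE \<omega> in M. \<bar>if P \<omega> then X \<omega> else 0\<bar> \<le> \<bar>A\<bar>" by eventually_elim auto
  moreover have "(\<lambda>\<omega>. if P \<omega> then X \<omega> else 0) \<in> borel_measurable M"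
    using assms by (intro measurable_If) (auto simp: ess_bounded_def)
  ultimately show ?thesis unfolding ess_bounded_def by blast
qed

text \<open>
  The orthogonality behind all moment computations: a function of the first \<open>k\<close> signs is
  independent of the next sign, whose mean is 0.
\<close>
lemma expectation_xi_past:
  assumes W: "W \<in> borel_measurable (F k)" and b: "ess_bounded W"
  shows "expectation (\<lambda>\<omega>. \<xi> (Suc k) \<omega> * W \<omega>) = 0"
proof -
  let ?E = "\<lambda>i. {\<xi> i -` A \<inter> space M | A. A \<in> sets borel}"
  \<comment> \<open>Split the signs into the next one and the first \<open>k\<close>; the two generated \<open>\<sigma>\<close>-algebras are independent.\<close>
  let ?I = "case_bool {Suc k} {1..k}"
  have IU: "(\<Union>j\<in>UNIV. ?I j) \<subseteq> {1..}" by (auto split: bool.splits)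
  have "indep_sets ?E {1..}" using indep unfolding indep_vars_def2 by auto
  then have "indep_sets ?E (\<Union>j\<in>UNIV. ?I j)" using IU by (rule indep_sets_mono_index[rotated])
  then have ind: "indep_sets (\<lambda>j. sigma_sets (space M) (\<Union>i\<in>?I j. ?E i)) UNIV"
  proof (rule indep_sets_collect_sigma)
    fix i show "Int_stable (?E i)"
      unfolding Int_stable_def
    proof clarify
      fix A B :: "real set" assume "A \<in> sets borel" "B \<in> sets borel"
      then show "\<exists>C. \<xi> i -` A \<inter> space M \<inter> (\<xi> i -` B \<inter> space M) = \<xi> i -` C \<inter> space M \<and> C \<in> sets borel"
        by (intro exI[of _ "A \<inter> B"]) auto
    qed
    show "disjoint_family_on ?I UNIV" by (auto simp: disjoint_family_on_def split: bool.splits)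
  qed
  have subW: "sigma_sets (space M) {W -` A \<inter> space M | A. A \<in> sets borel} \<subseteq> sigma_sets (space M) (\<Union>i\<in>{1..k}. ?E i)"
  proof -
    have "{W -` A \<inter> space M | A. A \<in> sets borel} \<subseteq> sets (F k)"
      using measurable_sets[OF W] by auto
    then have "sigma_sets (space (F k)) {W -` A \<inter> space M | A. A \<in> sets borel} \<subseteq> sets (F k)"
      by (rule sets.sigma_sets_subset)
    then show ?thesis by (simp add: sets_F)
  qed
  have "indep_set (sigma_sets (space M) (?E (Suc k))) (sigma_sets (space M) {W -` A \<inter> space M | A. A \<in> sets borel})"
    unfolding indep_set_def using ind
  proof (rule indep_sets_mono_sets)
    fix j :: bool
    show "(case j of True \<Rightarrow> sigma_sets (space M) (?E (Suc k)) | False \<Rightarrow> sigma_sets (space M) {W -` A \<inter> space M | A. A \<in> sets borel})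
      \<subseteq> sigma_sets (space M) (\<Union>i\<in>?I j. ?E i)"
      using subW by (cases j) auto
  qed
  then have iv: "indep_var borel (\<xi> (Suc k)) borel W"
    unfolding indep_var_eq using F_M[OF W] xi_measurable[of "Suc k"] by auto
  have "expectation (\<lambda>\<omega>. \<xi> (Suc k) \<omega> * W \<omega>) = expectation (\<xi> (Suc k)) * expectation W"
    using ess_bounded_integrable[OF b] ess_bounded_integrable[OF ess_bounded_xi] by (intro indep_var_lebesgue_integral iv) auto
  then show ?thesis using mean0[of "Suc k"] by simp
qed

text \<open>
  \<open>Z p\<close> multiplies the sign \<open>\<xi> p\<close>, so it may depend on the first \<open>p - 1\<close> signs; the first
  multiplier is a constant.
\<close>
definition predictable :: "(nat \<Rightarrow> 'a \<Rightarrow> real) \<Rightarrow> bool" where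
  "predictable Z \<longleftrightarrow> (\<forall>p\<ge>1. Z p \<in> borel_measurable (F (p - 1)) \<and> ess_bounded (Z p))"

definition transform :: "(nat \<Rightarrow> 'a \<Rightarrow> real) \<Rightarrow> nat \<Rightarrow> 'a \<Rightarrow> real" where
  "transform Z n \<omega> = (\<Sum>p\<in>{1..n}. \<xi> p \<omega> * Z p \<omega>)"

lemma predictableD:
  assumes "predictable Z" "1 \<le> p"
  shows "Z p \<in> borel_measurable (F (p - 1))" "ess_bounded (Z p)"
  using assms unfolding predictable_def by blast+

lemma transform_F: assumes "predictable Z" shows "transform Z n \<in> borel_measurable (F n)"
  unfolding transform_def
proof (rule borel_measurable_sum)
  fix p assume p: "p \<in> {1..n}"
  have "\<xi> p \<in> borel_measurable (F n)" using p by (intro xi_F) auto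
  moreover have "Z p \<in> borel_measurable (F n)"
    using p by (intro F_mono[OF predictableD(1)[OF assms]]) auto
  ultimately show "(\<lambda>\<omega>. \<xi> p \<omega> * Z p \<omega>) \<in> borel_measurable (F n)"
    by (rule borel_measurable_times)
qed

lemma transform_ess_bounded: assumes "predictable Z" shows "ess_bounded (transform Z n)"
  unfolding transform_def [abs_def]
proof (rule ess_bounded_sum)
  fix p assume "p \<in> {1..n}"
  then have p: "1 \<le> p" by simp
  show "ess_bounded (\<lambda>\<omega>. \<xi> p \<omega> * Z p \<omega>)"
    by (rule ess_bounded_mult[OF ess_bounded_xi[OF p] predictableD(2)[OF assms p]])
qed

lemma transform_isometry:
  assumes Z: "predictable Z"
  shows "expectation (\<lambda>\<omega>. (transform Z n \<omega>)\<^sup>2) = (\<Sum>p\<in>{1..n}. expectation (\<lambda>\<omega>. (Z p \<omega>)\<^sup>2))"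
proof (induction n)
  case 0 then show ?case by (simp add: transform_def)
next
  case (Suc n)
  let ?T = "transform Z n"
  have T: "?T \<in> borel_measurable (F n)" "ess_bounded ?T" using transform_F transform_ess_bounded Z by auto
  have Zn: "Z (Suc n) \<in> borel_measurable (F n)" "ess_bounded (Z (Suc n))"
    using Z[unfolded predictable_def, rule_format, of "Suc n"] by auto
  have sgn: "AE \<omega> in M. \<xi> (Suc n) \<omega> = 1 \<or> \<xi> (Suc n) \<omega> = -1" by (rule AE_sign) simp
  have "AE \<omega> in M. (transform Z (Suc n) \<omega>)\<^sup>2
     = ((?T \<omega>)\<^sup>2 + 2 * (\<xi> (Suc n) \<omega> * (Z (Suc n) \<omega> * ?T \<omega>))) + (Z (Suc n) \<omega>)\<^sup>2"
    using sgn
  proof eventually_elim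
    case (elim \<omega>)
    then have "(\<xi> (Suc n) \<omega>)\<^sup>2 = 1" by auto
    moreover have "transform Z (Suc n) \<omega> = ?T \<omega> + \<xi> (Suc n) \<omega> * Z (Suc n) \<omega>"
      by (simp add: transform_def)
    ultimately show ?case by (simp add: power2_sum power_mult_distrib)
  qed
  then have "expectation (\<lambda>\<omega>. (transform Z (Suc n) \<omega>)\<^sup>2)
     = expectation (\<lambda>\<omega>. ((?T \<omega>)\<^sup>2 + 2 * (\<xi> (Suc n) \<omega> * (Z (Suc n) \<omega> * ?T \<omega>))) + (Z (Suc n) \<omega>)\<^sup>2)"
    using ess_bounded_measurable[OF transform_ess_bounded[OF Z]] ess_bounded_measurable[OF Zn(2)] xi_measurable[of "Suc n"]
    by (intro integral_cong_AE) auto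
  also have "\<dots> = expectation (\<lambda>\<omega>. (?T \<omega>)\<^sup>2) + 2 * expectation (\<lambda>\<omega>. \<xi> (Suc n) \<omega> * (Z (Suc n) \<omega> * ?T \<omega>))
      + expectation (\<lambda>\<omega>. (Z (Suc n) \<omega>)\<^sup>2)"
  proof -
    have "integrable M (\<lambda>\<omega>. (?T \<omega>)\<^sup>2)" "integrable M (\<lambda>\<omega>. (Z (Suc n) \<omega>)\<^sup>2)"
      "integrable M (\<lambda>\<omega>. \<xi> (Suc n) \<omega> * (Z (Suc n) \<omega> * ?T \<omega>))"
      using T Zn by (auto intro!: ess_bounded_integrable ess_bounded_power2 ess_bounded_mult ess_bounded_xi)
    then show ?thesis by simp
  qed
  also have "expectation (\<lambda>\<omega>. \<xi> (Suc n) \<omega> * (Z (Suc n) \<omega> * ?T \<omega>)) = 0"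
    using T Zn by (intro expectation_xi_past ess_bounded_mult borel_measurable_times) auto
  finally show ?case using Suc.IH by simp
qed

text \<open>
  Kolmogorov's inequality.  Switching the multipliers off after the transform first reaches
  level \<open>a\<close> keeps them predictable and freezes the transform there, so the event is contained in
  the event that the modified transform is large at the single time \<open>N\<close>.  There Markov's
  inequality and the isometry apply.
\<close>
lemma maximal_inequality:
  assumes Z: "predictable Z" and c: "\<And>p. p \<in> {1..N} \<Longrightarrow> expectation (\<lambda>\<omega>. (Z p \<omega>)\<^sup>2) \<le> c"
    and a: "0 < a"
  shows "prob {\<omega> \<in> space M. \<exists>n\<le>N. a \<le> \<bar>transform Z n \<omega>\<bar>} \<le> real N * c / a\<^sup>2"
proof -
  define alive where "alive p \<omega> \<longleftrightarrow> (\<forall>q<p. \<bar>transform Z q \<omega>\<bar> < a)" for p \<omega>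
  define Z' where "Z' p \<omega> = (if alive p \<omega> then Z p \<omega> else 0)" for p \<omega>
  have alive_F: "Measurable.pred (F (p - 1)) (alive p)" if "1 \<le> p" for p
  proof -
    have "Measurable.pred (F (p - 1)) (\<lambda>\<omega>. \<forall>q\<in>{..<p}. \<bar>transform Z q \<omega>\<bar> < a)"
    proof (rule pred_intros_finite(3))
      fix q assume "q \<in> {..<p}"
      then have "q \<le> p - 1" by auto
      from F_mono[OF transform_F[OF Z] this]
      have "(\<lambda>\<omega>. \<bar>transform Z q \<omega>\<bar>) \<in> borel_measurable (F (p - 1))" by (rule borel_measurable_abs)
      then show "Measurable.pred (F (p - 1)) (\<lambda>\<omega>. \<bar>transform Z q \<omega>\<bar> < a)"
        by (rule borel_measurable_pred_less[OF _ borel_measurable_const])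
    qed simp
    moreover have "alive p = (\<lambda>\<omega>. \<forall>q\<in>{..<p}. \<bar>transform Z q \<omega>\<bar> < a)"
      by (auto simp: fun_eq_iff alive_def)
    ultimately show ?thesis by simp
  qed
  have alive_M: "Measurable.pred M (alive p)" if "1 \<le> p" for p
    using alive_F[OF that] sets_F_M[of "p - 1"] unfolding pred_def by auto
  have Z': "predictable Z'"
    unfolding predictable_def Z'_def[abs_def]
  proof (intro allI impI conjI)
    fix p :: nat assume p: "1 \<le> p"
    show "(\<lambda>\<omega>. if alive p \<omega> then Z p \<omega> else 0) \<in> borel_measurable (F (p - 1))"
      using alive_F[OF p] predictableD(1)[OF Z p] by (intro measurable_If) (simp_all add: pred_def)
    show "ess_bounded (\<lambda>\<omega>. if alive p \<omega> then Z p \<omega> else 0)"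
      by (rule ess_bounded_restrict[OF predictableD(2)[OF Z p] alive_M[OF p]])
  qed
  have "{\<omega> \<in> space M. \<exists>n\<le>N. a \<le> \<bar>transform Z n \<omega>\<bar>} \<subseteq> {\<omega> \<in> space M. a\<^sup>2 \<le> (transform Z' N \<omega>)\<^sup>2}"
  proof clarsimp
    fix \<omega> n assume n: "n \<le> N" "a \<le> \<bar>transform Z n \<omega>\<bar>"
    define t where "t = (LEAST n. a \<le> \<bar>transform Z n \<omega>\<bar>)"
    have t: "a \<le> \<bar>transform Z t \<omega>\<bar>" unfolding t_def using n(2) by (rule LeastI)
    have tN: "t \<le> N" using Least_le[of "\<lambda>n. a \<le> \<bar>transform Z n \<omega>\<bar>" n] n unfolding t_def by linarith
    have before: "\<bar>transform Z q \<omega>\<bar> < a" if "q < t" for q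
      using not_less_Least[OF that[unfolded t_def]] by simp
    have "transform Z' N \<omega> = (\<Sum>p\<in>{1..t}. \<xi> p \<omega> * Z' p \<omega>)"
      unfolding transform_def
    proof (rule sum.mono_neutral_right)
      show "\<forall>p\<in>{1..N} - {1..t}. \<xi> p \<omega> * Z' p \<omega> = 0"
      proof
        fix p assume "p \<in> {1..N} - {1..t}"
        then have "t < p" by auto
        then have "\<not> alive p \<omega>" using t unfolding alive_def by (meson not_less)
        then show "\<xi> p \<omega> * Z' p \<omega> = 0" by (simp add: Z'_def)
      qed
    qed (use tN in auto)
    also have "\<dots> = transform Z t \<omega>"
      unfolding transform_def using before by (intro sum.cong) (auto simp: Z'_def alive_def)
    finally show "a\<^sup>2 \<le> (transform Z' N \<omega>)\<^sup>2" using t a by (simp add: abs_le_square_iff[symmetric])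
  qed
  moreover have "{\<omega> \<in> space M. a\<^sup>2 \<le> (transform Z' N \<omega>)\<^sup>2} \<in> events"
    using ess_bounded_measurable[OF transform_ess_bounded[OF Z']] by measurable
  ultimately have "prob {\<omega> \<in> space M. \<exists>n\<le>N. a \<le> \<bar>transform Z n \<omega>\<bar>} \<le> prob {\<omega> \<in> space M. a\<^sup>2 \<le> (transform Z' N \<omega>)\<^sup>2}"
    by (intro finite_measure_mono) auto
  also have "\<dots> \<le> expectation (\<lambda>\<omega>. (transform Z' N \<omega>)\<^sup>2) / a\<^sup>2"
    using a transform_ess_bounded[OF Z']
    by (intro integral_Markov_inequality_measure[where A="{}"] ess_bounded_integrable ess_bounded_power2) auto
  also have "\<dots> = (\<Sum>p\<in>{1..N}. expectation (\<lambda>\<omega>. (Z' p \<omega>)\<^sup>2)) / a\<^sup>2"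
    by (simp add: transform_isometry[OF Z'])
  also have "\<dots> \<le> (\<Sum>p\<in>{1..N}. c) / a\<^sup>2"
  proof (intro divide_right_mono sum_mono)
    fix p assume p: "p \<in> {1..N}"
    then have p1: "1 \<le> p" by simp
    have "expectation (\<lambda>\<omega>. (Z' p \<omega>)\<^sup>2) \<le> expectation (\<lambda>\<omega>. (Z p \<omega>)\<^sup>2)"
    proof (rule integral_mono)
      show "integrable M (\<lambda>\<omega>. (Z' p \<omega>)\<^sup>2)" "integrable M (\<lambda>\<omega>. (Z p \<omega>)\<^sup>2)"
        using predictableD(2)[OF Z p1] predictableD(2)[OF Z' p1] by (auto intro: ess_bounded_integrable ess_bounded_power2)
    qed (simp add: Z'_def)
    with c[OF p] show "expectation (\<lambda>\<omega>. (Z' p \<omega>)\<^sup>2) \<le> c" by simp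
  qed simp
  finally show ?thesis by simp
qed

end

section \<open>Martingales inside the consecutive products\<close>
locale fractional_market = rademacher M \<xi> for M :: "'a measure" and \<xi> +
  fixes H \<sigma> :: real
  assumes H: "1/2 < H" "H < 1" and sigma: "0 < \<sigma>"
begin

text \<open>
  Setting the coefficients to 0 from index \<open>k\<close> on lets \<open>Y_past k\<close> be read off from \<open>Y_upto k p\<close>
  at every \<open>p \<ge> k\<close>, so that two consecutive past sums can be compared over one index range.
\<close>
definition past_coef :: "nat \<Rightarrow> nat \<Rightarrow> real" where
  "past_coef k i = (if i < k then coef_j H \<sigma> k i else 0)"

text \<open>The part of \<open>Y_past k\<close> that is known after \<open>p - 1\<close> signs.\<close>
definition Y_upto :: "nat \<Rightarrow> nat \<Rightarrow> 'a \<Rightarrow> real" where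
  "Y_upto k p \<omega> = (\<Sum>i\<in>{1..<p}. past_coef k i * \<xi> i \<omega>)"

lemma past_coef_nonneg: "0 \<le> past_coef k i"
  using coef_j_nonneg[OF H sigma] by (simp add: past_coef_def)

lemma Y_upto_Suc: "1 \<le> p \<Longrightarrow> Y_upto k (Suc p) \<omega> = Y_upto k p \<omega> + past_coef k p * \<xi> p \<omega>"
  by (simp add: Y_upto_def)

lemma Y_past_eq: "k \<le> p \<Longrightarrow> Y_past H \<sigma> \<xi> k \<omega> = Y_upto k p \<omega>"
  unfolding Y_past_def Y_upto_def by (rule sum.mono_neutral_cong_left) (auto simp: past_coef_def)

lemma predictable_const: "predictable (\<lambda>p \<omega>. a p)"
  by (simp add: predictable_def ess_bounded_const)

lemma Y_upto_transform: "Y_upto k p = transform (\<lambda>i \<omega>. past_coef k i) (p - 1)"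
proof -
  have "{1..p-1} = {1..<p}" by auto
  then show ?thesis by (auto simp: fun_eq_iff Y_upto_def transform_def mult.commute)
qed

lemma Y_upto_F: "p - 1 \<le> i \<Longrightarrow> Y_upto k p \<in> borel_measurable (F i)"
  unfolding Y_upto_transform by (rule F_mono[OF transform_F[OF predictable_const]])

lemma Y_upto_ess_bounded: "ess_bounded (Y_upto k p)"
  unfolding Y_upto_transform by (rule transform_ess_bounded[OF predictable_const])

lemma Y_past_F: "k - 1 \<le> i \<Longrightarrow> Y_past H \<sigma> \<xi> k \<in> borel_measurable (F i)"
proof -
  assume "k - 1 \<le> i"
  moreover have "Y_past H \<sigma> \<xi> k = Y_upto k k" using Y_past_eq[of k k] by blast
  ultimately show ?thesis using Y_upto_F by simp
qed

lemma Y_upto_second_moment: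
  assumes K: "\<And>n. (\<Sum>i\<in>{1..<n}. (coef_j H \<sigma> n i)\<^sup>2) \<le> K"
  shows "expectation (\<lambda>\<omega>. (Y_upto k p \<omega>)\<^sup>2) \<le> K"
proof -
  have "expectation (\<lambda>\<omega>. (Y_upto k p \<omega>)\<^sup>2) = (\<Sum>i\<in>{1..p-1}. (past_coef k i)\<^sup>2)"
    unfolding Y_upto_transform by (subst transform_isometry[OF predictable_const]) (simp add: prob_space)
  also have "\<dots> = (\<Sum>i\<in>{1..p-1} \<inter> {1..<k}. (past_coef k i)\<^sup>2)"
    by (rule sum.mono_neutral_right) (auto simp: past_coef_def)
  also have "\<dots> \<le> (\<Sum>i\<in>{1..<k}. (past_coef k i)\<^sup>2)" by (rule sum_mono2) auto
  also have "\<dots> = (\<Sum>i\<in>{1..<k}. (coef_j H \<sigma> k i)\<^sup>2)" by (simp add: past_coef_def)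
  also have "\<dots> \<le> K" by (rule K)
  finally show ?thesis .
qed

lemma past_coef_square_le:
  assumes K: "\<And>n. (\<Sum>i\<in>{1..<n}. (coef_j H \<sigma> n i)\<^sup>2) \<le> K" and i: "1 \<le> i"
  shows "(past_coef k i)\<^sup>2 \<le> K"
proof (cases "i < k")
  case True
  then have "(past_coef k i)\<^sup>2 \<le> (\<Sum>i\<in>{1..<k}. (coef_j H \<sigma> k i)\<^sup>2)"
    using i by (simp add: past_coef_def) (rule member_le_sum, auto)
  then show ?thesis using K[of k] by simp
next
  case False
  then show ?thesis using K[of 0] by (simp add: past_coef_def)
qed

text \<open>
  The following multipliers of \<open>\<xi> p\<close> give the martingale parts of \<open>theta 1\<close>, \<open>theta 2\<close> and
  \<open>theta 3\<close>, in this order.  In \<open>theta 3 k\<close> the sign \<open>\<xi> (k - 1)\<close> occurs also inside \<open>Y_past k\<close>;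
  \<open>stale_coef\<close>, with \<open>p = k - 1\<close>, keeps only the earlier signs there.
\<close>
definition pair_coef :: "nat \<Rightarrow> 'a \<Rightarrow> real" where
  "pair_coef p \<omega> = (if 2 \<le> p then coef_g H \<sigma> (p - 1) * coef_g H \<sigma> p * \<xi> (p - 1) \<omega> else 0)"

definition fresh_coef :: "nat \<Rightarrow> 'a \<Rightarrow> real" where
  "fresh_coef p \<omega> = coef_g H \<sigma> p * Y_upto (p - 1) p \<omega>"

definition stale_coef :: "nat \<Rightarrow> 'a \<Rightarrow> real" where
  "stale_coef p \<omega> = coef_g H \<sigma> p * Y_upto (p + 1) p \<omega>"

text \<open>
  Revealing \<open>\<xi> p\<close> changes the product of the partial sums of \<open>Y_past (k - 1)\<close> and \<open>Y_past k\<close>, for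
  \<open>k = p + l\<close>, by a constant plus \<open>\<xi> p * lag_coef l p\<close>.
\<close>
definition lag_coef :: "nat \<Rightarrow> nat \<Rightarrow> 'a \<Rightarrow> real" where
  "lag_coef l p \<omega> = past_coef (p + l - 1) p * Y_upto (p + l) p \<omega> + past_coef (p + l) p * Y_upto (p + l - 1) p \<omega>"

lemma predictable_pair: "predictable pair_coef"
  unfolding predictable_def
proof (intro allI impI conjI)
  fix p :: nat assume "1 \<le> p"
  have "pair_coef p \<in> borel_measurable (F (p - 1)) \<and> ess_bounded (pair_coef p)"
  proof (cases "2 \<le> p")
    case True
    then have "pair_coef p = (\<lambda>\<omega>. coef_g H \<sigma> (p - 1) * coef_g H \<sigma> p * \<xi> (p - 1) \<omega>)"
      by (simp add: fun_eq_iff pair_coef_def)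
    moreover have "\<xi> (p - 1) \<in> borel_measurable (F (p - 1))" "ess_bounded (\<xi> (p - 1))"
      using True by (auto intro: xi_F ess_bounded_xi)
    ultimately show ?thesis by (simp add: ess_bounded_mult ess_bounded_const)
  next
    case False
    then have "pair_coef p = (\<lambda>\<omega>. 0)" by (simp add: fun_eq_iff pair_coef_def)
    then show ?thesis by (simp add: ess_bounded_const)
  qed
  then show "pair_coef p \<in> borel_measurable (F (p - 1))" "ess_bounded (pair_coef p)" by auto
qed

lemma predictable_fresh: "predictable fresh_coef"
  unfolding predictable_def fresh_coef_def[abs_def]
  by (auto intro!: borel_measurable_times borel_measurable_const Y_upto_F ess_bounded_mult ess_bounded_const Y_upto_ess_bounded)

lemma predictable_stale: "predictable stale_coef"
  unfolding predictable_def stale_coef_def[abs_def]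
  by (auto intro!: borel_measurable_times borel_measurable_const Y_upto_F ess_bounded_mult ess_bounded_const Y_upto_ess_bounded)

lemma predictable_lag: "predictable (lag_coef l)"
  unfolding predictable_def lag_coef_def[abs_def]
  by (auto intro!: borel_measurable_add borel_measurable_times borel_measurable_const Y_upto_F
      ess_bounded_add ess_bounded_mult ess_bounded_const Y_upto_ess_bounded)

lemma second_moment_scaled_Y_upto:
  assumes K: "\<And>n. (\<Sum>i\<in>{1..<n}. (coef_j H \<sigma> n i)\<^sup>2) \<le> K" and c: "0 \<le> c" "c \<le> G"
  shows "expectation (\<lambda>\<omega>. (c * Y_upto k p \<omega>)\<^sup>2) \<le> G\<^sup>2 * K"
proof -
  have "expectation (\<lambda>\<omega>. (c * Y_upto k p \<omega>)\<^sup>2) = c\<^sup>2 * expectation (\<lambda>\<omega>. (Y_upto k p \<omega>)\<^sup>2)"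
    by (simp add: power_mult_distrib)
  also have "\<dots> \<le> G\<^sup>2 * K"
    using c by (intro mult_mono Y_upto_second_moment[OF K] power_mono) auto
  finally show ?thesis .
qed

lemma second_moment_lag:
  assumes K: "\<And>n. (\<Sum>i\<in>{1..<n}. (coef_j H \<sigma> n i)\<^sup>2) \<le> K" and p: "1 \<le> p"
  shows "expectation (\<lambda>\<omega>. (lag_coef l p \<omega>)\<^sup>2) \<le> 4 * K\<^sup>2"
proof -
  have K0: "0 \<le> K" using K[of 0] by simp
  let ?a = "past_coef (p + l - 1) p" and ?b = "past_coef (p + l) p"
  let ?X = "Y_upto (p + l) p" and ?Y = "Y_upto (p + l - 1) p"
  have i: "integrable M (\<lambda>\<omega>. (?X \<omega>)\<^sup>2)" "integrable M (\<lambda>\<omega>. (?Y \<omega>)\<^sup>2)" "integrable M (\<lambda>\<omega>. (lag_coef l p \<omega>)\<^sup>2)"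
    using predictableD(2)[OF predictable_lag p] by (auto intro: ess_bounded_integrable ess_bounded_power2 Y_upto_ess_bounded)
  have "expectation (\<lambda>\<omega>. (lag_coef l p \<omega>)\<^sup>2) \<le> expectation (\<lambda>\<omega>. 2 * ?a\<^sup>2 * (?X \<omega>)\<^sup>2 + 2 * ?b\<^sup>2 * (?Y \<omega>)\<^sup>2)"
  proof (rule integral_mono)
    fix \<omega>
    have "0 \<le> (?a * ?X \<omega> - ?b * ?Y \<omega>)\<^sup>2" by simp
    then show "(lag_coef l p \<omega>)\<^sup>2 \<le> 2 * ?a\<^sup>2 * (?X \<omega>)\<^sup>2 + 2 * ?b\<^sup>2 * (?Y \<omega>)\<^sup>2"
      unfolding lag_coef_def by (simp add: power2_eq_square algebra_simps)
  qed (use i in auto)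
  also have "\<dots> = 2 * ?a\<^sup>2 * expectation (\<lambda>\<omega>. (?X \<omega>)\<^sup>2) + 2 * ?b\<^sup>2 * expectation (\<lambda>\<omega>. (?Y \<omega>)\<^sup>2)"
    using i by simp
  also have "\<dots> \<le> 2 * K * K + 2 * K * K"
    using K0 p by (intro add_mono mult_mono Y_upto_second_moment[OF K] past_coef_square_le[OF K]) auto
  finally show ?thesis by (simp add: power2_eq_square)
qed

lemma second_moment_xi: assumes "1 \<le> i" shows "expectation (\<lambda>\<omega>. (\<xi> i \<omega>)\<^sup>2) = 1"
proof -
  have "expectation (\<lambda>\<omega>. (\<xi> i \<omega>)\<^sup>2) = expectation (\<lambda>\<omega>. 1)"
  proof (rule integral_cong_AE)
    show "AE \<omega> in M. (\<xi> i \<omega>)\<^sup>2 = 1" using AE_sign[OF assms] by eventually_elim auto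
    show "(\<lambda>\<omega>. (\<xi> i \<omega>)\<^sup>2) \<in> borel_measurable M" using xi_measurable[OF assms] by simp
  qed simp
  then show ?thesis by (simp add: prob_space)
qed

text \<open>All multipliers in one family, so that one event can control every martingale.\<close>
definition noise_coef :: "nat \<Rightarrow> nat \<Rightarrow> 'a \<Rightarrow> real" where
  "noise_coef i = (if i = 0 then pair_coef else if i = 1 then fresh_coef else if i = 2 then stale_coef
              else lag_coef (i - 2))"

lemma predictable_noise_coef: "predictable (noise_coef i)"
  by (simp add: noise_coef_def predictable_pair predictable_fresh predictable_stale predictable_lag)

lemma noise_second_moments_bounded:
  obtains c where "0 < c" "\<And>i p. 1 \<le> p \<Longrightarrow> expectation (\<lambda>\<omega>. (noise_coef i p \<omega>)\<^sup>2) \<le> c"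
proof -
  obtain K where K: "0 < K" "\<And>n. (\<Sum>i\<in>{1..<n}. (coef_j H \<sigma> n i)\<^sup>2) \<le> K"
    using coef_j_square_sum_bounded[OF H sigma] by blast
  define G where "G = \<sigma> * C_frac H / ((H - 1/2) * (3/2 - H))"
  have g: "0 \<le> coef_g H \<sigma> n" "coef_g H \<sigma> n \<le> G" if "1 \<le> n" for n
    using coef_g_bounds[OF H sigma that] by (auto simp: G_def)
  have G0: "0 \<le> G" using g[of 1] by simp
  let ?c = "(G * G)\<^sup>2 + G\<^sup>2 * K + 4 * K\<^sup>2"
  have "expectation (\<lambda>\<omega>. (noise_coef i p \<omega>)\<^sup>2) \<le> ?c" if p: "1 \<le> p" for i p
  proof -
    have n1: "0 \<le> (G * G)\<^sup>2" "0 \<le> G\<^sup>2 * K" "0 \<le> 4 * K\<^sup>2" using K by auto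
    have 0: "expectation (\<lambda>\<omega>. (pair_coef p \<omega>)\<^sup>2) \<le> (G * G)\<^sup>2"
    proof (cases "2 \<le> p")
      case True
      have "expectation (\<lambda>\<omega>. (pair_coef p \<omega>)\<^sup>2) = (coef_g H \<sigma> (p - 1) * coef_g H \<sigma> p)\<^sup>2"
        using True second_moment_xi[of "p - 1"] by (simp add: pair_coef_def power_mult_distrib)
      also have "\<dots> \<le> (G * G)\<^sup>2"
        using True g by (intro power_mono mult_mono mult_nonneg_nonneg G0) auto
      finally show ?thesis .
    qed (use n1 in \<open>simp add: pair_coef_def\<close>)
    have 1: "expectation (\<lambda>\<omega>. (fresh_coef p \<omega>)\<^sup>2) \<le> G\<^sup>2 * K"
      unfolding fresh_coef_def by (rule second_moment_scaled_Y_upto[OF K(2) g[OF p]])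
    have 2: "expectation (\<lambda>\<omega>. (stale_coef p \<omega>)\<^sup>2) \<le> G\<^sup>2 * K"
      unfolding stale_coef_def by (rule second_moment_scaled_Y_upto[OF K(2) g[OF p]])
    have 3: "expectation (\<lambda>\<omega>. (lag_coef (i - 2) p \<omega>)\<^sup>2) \<le> 4 * K\<^sup>2"
      by (rule second_moment_lag[OF K(2) p])
    show ?thesis
    proof (cases "i = 0 \<or> i = 1 \<or> i = 2")
      case True
      then show ?thesis using 0 1 2 n1 by (elim disjE; simp only: noise_coef_def; simp; linarith)
    next
      case False
      then show ?thesis using 3 n1 by (simp add: noise_coef_def; linarith)
    qed
  qed
  moreover have "0 < ?c" using K by (simp add: add_nonneg_pos)
  ultimately show ?thesis by (rule that[rotated])
qed

definition calm :: "nat \<Rightarrow> nat \<Rightarrow> real \<Rightarrow> 'a \<Rightarrow> bool" where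
  "calm L N a \<omega> \<longleftrightarrow> (\<forall>i<L. \<forall>n\<le>N. \<bar>transform (noise_coef i) n \<omega>\<bar> < a)"

lemma prob_not_calm:
  assumes c: "\<And>i p. 1 \<le> p \<Longrightarrow> expectation (\<lambda>\<omega>. (noise_coef i p \<omega>)\<^sup>2) \<le> c" and a: "0 < a"
  shows "{\<omega> \<in> space M. \<not> calm L N a \<omega>} \<in> events"
    and "prob {\<omega> \<in> space M. \<not> calm L N a \<omega>} \<le> real L * (real N * c / a\<^sup>2)"
proof -
  let ?B = "\<lambda>i. {\<omega> \<in> space M. \<exists>n\<le>N. a \<le> \<bar>transform (noise_coef i) n \<omega>\<bar>}"
  have B: "?B i \<in> events" for i
  proof -
    have *: "{\<omega> \<in> space M. a \<le> \<bar>transform (noise_coef i) n \<omega>\<bar>} \<in> events" for n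
    proof -
      have [measurable]: "transform (noise_coef i) n \<in> borel_measurable M"
        by (rule ess_bounded_measurable[OF transform_ess_bounded[OF predictable_noise_coef]])
      show ?thesis by measurable
    qed
    have "?B i = (\<Union>n\<in>{..N}. {\<omega> \<in> space M. a \<le> \<bar>transform (noise_coef i) n \<omega>\<bar>})" by auto
    also have "\<dots> \<in> events" using * by (intro sets.finite_UN) blast+
    finally show ?thesis .
  qed
  have eq: "{\<omega> \<in> space M. \<not> calm L N a \<omega>} = (\<Union>i\<in>{..<L}. ?B i)"
    unfolding calm_def not_less not_all not_imp by blast
  show "{\<omega> \<in> space M. \<not> calm L N a \<omega>} \<in> events"
    unfolding eq by (rule sets.finite_UN[OF finite_lessThan B])
  have "prob (\<Union>i\<in>{..<L}. ?B i) \<le> (\<Sum>i\<in>{..<L}. prob (?B i))"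
  proof (rule finite_measure_subadditive_finite)
    show "?B ` {..<L} \<subseteq> events" using B by blast
  qed simp
  also have "\<dots> \<le> (\<Sum>i\<in>{..<L}. real N * c / a\<^sup>2)"
  proof (rule sum_mono)
    fix i
    show "prob (?B i) \<le> real N * c / a\<^sup>2"
    proof (rule maximal_inequality[OF predictable_noise_coef _ a])
      fix p assume "p \<in> {1..N}"
      then show "expectation (\<lambda>\<omega>. (noise_coef i p \<omega>)\<^sup>2) \<le> c" by (intro c) simp
    qed
  qed
  finally show "prob {\<omega> \<in> space M. \<not> calm L N a \<omega>} \<le> real L * (real N * c / a\<^sup>2)"
    unfolding eq by simp
qed

lemma theta_sum_1: "theta_sum H \<sigma> \<xi> 1 n \<omega> = transform pair_coef n \<omega>"
  unfolding theta_sum_def transform_def by (intro sum.cong) (auto simp: theta_def pair_coef_def)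

lemma theta_sum_2: "theta_sum H \<sigma> \<xi> 2 n \<omega> = transform fresh_coef n \<omega>"
  unfolding theta_sum_def transform_def
proof (intro sum.cong refl)
  fix k assume "k \<in> {1..n}"
  then show "theta H \<sigma> \<xi> 2 k \<omega> = \<xi> k \<omega> * fresh_coef k \<omega>"
    using Y_past_eq[of "k - 1" k \<omega>] by (cases "k < 2") (auto simp: theta_def fresh_coef_def Y_upto_def)
qed

text \<open>
  The sign \<open>\<xi> (k - 1)\<close> multiplies its own occurrence in \<open>Y_past k\<close>, which leaves a nonnegative
  term; the sum up to \<open>Suc n\<close> involves the multipliers up to \<open>n\<close> only.
\<close>
lemma theta_sum_3: "transform stale_coef n \<omega> \<le> theta_sum H \<sigma> \<xi> 3 (Suc n) \<omega>"
proof (induction n)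
  case 0 then show ?case by (simp add: transform_def theta_sum_def theta_def)
next
  case (Suc n)
  have "Y_past H \<sigma> \<xi> (Suc (Suc n)) \<omega> = Y_upto (Suc (Suc n)) (Suc n) \<omega> + past_coef (Suc (Suc n)) (Suc n) * \<xi> (Suc n) \<omega>"
    using Y_past_eq[of "Suc (Suc n)" "Suc (Suc n)" \<omega>] Y_upto_Suc[of "Suc n"] by simp
  then have "theta H \<sigma> \<xi> 3 (Suc (Suc n)) \<omega> = \<xi> (Suc n) \<omega> * stale_coef (Suc n) \<omega>
      + coef_g H \<sigma> (Suc n) * past_coef (Suc (Suc n)) (Suc n) * (\<xi> (Suc n) \<omega>)\<^sup>2"
    by (simp add: theta_def stale_coef_def power2_eq_square algebra_simps)
  moreover have "0 \<le> coef_g H \<sigma> (Suc n) * past_coef (Suc (Suc n)) (Suc n) * (\<xi> (Suc n) \<omega>)\<^sup>2"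
    using coef_g_bounds(1)[OF H sigma, of "Suc n"] by (intro mult_nonneg_nonneg past_coef_nonneg) auto
  ultimately show ?case using Suc.IH by (simp add: transform_def theta_sum_def)
qed

text \<open>
  The positive correlation of consecutive past sums.  From the first index \<open>q\<close> of the window on,
  the product of the partial sums telescopes into martingale increments and the diagonal.  For
  \<open>k \<ge> 3\<close> the sign \<open>k - 2\<close> lies in the window and enters both sums with a weight of at least
  \<open>b0\<close>.  The product of the remote parts is at least minus half the square of their difference,
  that is at least \<open>- b0\<^sup>2 / 2\<close>; so half of the diagonal survives.
\<close>
lemma consecutive_product_lower_bound:
  assumes sg: "\<And>i. 1 \<le> i \<Longrightarrow> (\<xi> i \<omega>)\<^sup>2 = 1"
    and m: "2 \<le> m" and k: "1 \<le> k"
    and b0: "0 \<le> b0" "\<And>n i. 1 \<le> i \<Longrightarrow> i < n \<Longrightarrow> n \<le> i + 2 \<Longrightarrow> b0 \<le> coef_j H \<sigma> n i"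
    and d: "\<And>n. (\<Sum>i\<in>{1..<n-m}. \<bar>coef_j H \<sigma> n i - coef_j H \<sigma> (n - 1) i\<bar>) \<le> b0"
  shows "(if 3 \<le> k then b0\<^sup>2 / 2 else 0) + (\<Sum>l\<in>{1..m}. if l < k then \<xi> (k - l) \<omega> * lag_coef l (k - l) \<omega> else 0)
     \<le> Y_past H \<sigma> \<xi> (k - 1) \<omega> * Y_past H \<sigma> \<xi> k \<omega>"
proof -
  let ?A = "\<lambda>p. Y_upto (k - 1) p \<omega>" and ?B = "\<lambda>p. Y_upto k p \<omega>"
  let ?a = "past_coef (k - 1)" and ?b = "past_coef k"
  \<comment> \<open>The window starts at 1 if at most \<open>m\<close> signs precede; then there is no remote part.\<close>
  define q where "q = max 1 (k - m)"
  have q: "1 \<le> q" "q \<le> k" using k m by (auto simp: q_def)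
  have step: "?A (Suc p) * ?B (Suc p) - ?A p * ?B p
      = \<xi> p \<omega> * (?a p * ?B p + ?b p * ?A p) + ?a p * ?b p" if "p \<in> {q..<k}" for p
  proof -
    have p: "1 \<le> p" using that q by auto
    have "?A (Suc p) * ?B (Suc p) - ?A p * ?B p
      = \<xi> p \<omega> * (?a p * ?B p + ?b p * ?A p) + ?a p * ?b p * (\<xi> p \<omega>)\<^sup>2"
      using Y_upto_Suc[OF p] by (simp add: power2_eq_square algebra_simps)
    then show ?thesis using sg[OF p] by simp
  qed
  have tele: "?A k * ?B k - ?A q * ?B q
     = (\<Sum>p\<in>{q..<k}. \<xi> p \<omega> * (?a p * ?B p + ?b p * ?A p)) + (\<Sum>p\<in>{q..<k}. ?a p * ?b p)"
    using sum_Suc_diff'[of q k "\<lambda>p. ?A p * ?B p"] q step by (simp add: sum.distrib)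
  have "(\<Sum>p\<in>{q..<k}. \<xi> p \<omega> * (?a p * ?B p + ?b p * ?A p))
     = (\<Sum>l\<in>{l \<in> {1..m}. l < k}. \<xi> (k - l) \<omega> * lag_coef l (k - l) \<omega>)"
    by (rule sum.reindex_bij_witness[of _ "\<lambda>l. k - l" "\<lambda>p. k - p"]) (auto simp: q_def lag_coef_def)
  also have "\<dots> = (\<Sum>l\<in>{1..m}. if l < k then \<xi> (k - l) \<omega> * lag_coef l (k - l) \<omega> else 0)"
    by (rule sum.inter_filter) simp
  finally have lags: "(\<Sum>p\<in>{q..<k}. \<xi> p \<omega> * (?a p * ?B p + ?b p * ?A p)) = \<dots>" .
  have diag: "(if 3 \<le> k then b0\<^sup>2 else 0) \<le> (\<Sum>p\<in>{q..<k}. ?a p * ?b p)"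
  proof (cases "3 \<le> k")
    case True
    have "b0 * b0 \<le> ?a (k - 2) * ?b (k - 2)"
      using True b0 by (intro mult_mono past_coef_nonneg) (auto simp: past_coef_def)
    also have "\<dots> \<le> (\<Sum>p\<in>{q..<k}. ?a p * ?b p)"
      using True m by (intro member_le_sum[of "k - 2" _ "\<lambda>p. ?a p * ?b p"] mult_nonneg_nonneg past_coef_nonneg) (auto simp: q_def)
    finally show ?thesis using True by (simp add: power2_eq_square)
  qed (auto intro!: sum_nonneg mult_nonneg_nonneg past_coef_nonneg)
  have "\<bar>?B q - ?A q\<bar> \<le> (if m < k then b0 else 0)"
  proof (cases "m < k")
    case True
    then have qk: "q = k - m" by (simp add: q_def)
    have "?B q - ?A q = (\<Sum>i\<in>{1..<q}. (coef_j H \<sigma> k i - coef_j H \<sigma> (k - 1) i) * \<xi> i \<omega>)"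
      unfolding Y_upto_def sum_subtractf[symmetric] using qk m
      by (intro sum.cong) (auto simp: past_coef_def algebra_simps)
    also have "\<bar>\<dots>\<bar> \<le> (\<Sum>i\<in>{1..<q}. \<bar>(coef_j H \<sigma> k i - coef_j H \<sigma> (k - 1) i) * \<xi> i \<omega>\<bar>)" by (rule sum_abs)
    also have "\<dots> = (\<Sum>i\<in>{1..<q}. \<bar>coef_j H \<sigma> k i - coef_j H \<sigma> (k - 1) i\<bar>)"
    proof (intro sum.cong refl)
      fix i assume "i \<in> {1..<q}"
      then have "\<bar>\<xi> i \<omega>\<bar> = 1" using sg[of i] by (auto simp: power2_eq_1_iff)
      then show "\<bar>(coef_j H \<sigma> k i - coef_j H \<sigma> (k - 1) i) * \<xi> i \<omega>\<bar> = \<bar>coef_j H \<sigma> k i - coef_j H \<sigma> (k - 1) i\<bar>"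
        by (simp add: abs_mult)
    qed
    also have "\<dots> \<le> b0" using d[of k] qk by simp
    finally show ?thesis using True by simp
  next
    case False
    then have "q = 1" by (simp add: q_def)
    then show ?thesis using False by (simp add: Y_upto_def)
  qed
  then have "(?B q - ?A q)\<^sup>2 \<le> (if m < k then b0 else 0)\<^sup>2" by (simp add: abs_le_square_iff[symmetric] split: if_splits)
  also have "\<dots> \<le> (if 3 \<le> k then b0\<^sup>2 else 0)" using m by auto
  finally have "(?B q)\<^sup>2 + (?A q)\<^sup>2 - 2 * (?A q * ?B q) \<le> (if 3 \<le> k then b0\<^sup>2 else 0)"
    by (simp add: power2_diff mult_ac)
  then have "- (if 3 \<le> k then b0\<^sup>2 else 0) / 2 \<le> ?A q * ?B q"
    using zero_le_power2[of "?A q"] zero_le_power2[of "?B q"] by linarith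
  then have "(if 3 \<le> k then b0\<^sup>2 / 2 else 0) + (\<Sum>l\<in>{1..m}. if l < k then \<xi> (k - l) \<omega> * lag_coef l (k - l) \<omega> else 0) \<le> ?A k * ?B k"
    using tele diag unfolding lags by (cases "3 \<le> k"; simp)
  then show ?thesis using Y_past_eq[of "k - 1" k \<omega>] Y_past_eq[of k k \<omega>] by simp
qed

lemma theta_sum_4:
  assumes sg: "\<And>i. 1 \<le> i \<Longrightarrow> (\<xi> i \<omega>)\<^sup>2 = 1"
    and m: "2 \<le> m"
    and b0: "0 \<le> b0" "\<And>n i. 1 \<le> i \<Longrightarrow> i < n \<Longrightarrow> n \<le> i + 2 \<Longrightarrow> b0 \<le> coef_j H \<sigma> n i"
    and d: "\<And>n. (\<Sum>i\<in>{1..<n-m}. \<bar>coef_j H \<sigma> n i - coef_j H \<sigma> (n - 1) i\<bar>) \<le> b0"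
  shows "b0\<^sup>2 / 2 * real (n - 2) + (\<Sum>l\<in>{1..m}. transform (lag_coef l) (n - l) \<omega>) \<le> theta_sum H \<sigma> \<xi> 4 n \<omega>"
proof -
  let ?h = "\<lambda>k l. if l < k then \<xi> (k - l) \<omega> * lag_coef l (k - l) \<omega> else 0"
  have "(\<Sum>k\<in>{1..n}. (if 3 \<le> k then b0\<^sup>2 / 2 else 0) + (\<Sum>l\<in>{1..m}. ?h k l)) \<le> theta_sum H \<sigma> \<xi> 4 n \<omega>"
    unfolding theta_sum_def
  proof (rule sum_mono)
    fix k assume "k \<in> {1..n}"
    then have k: "1 \<le> k" by simp
    have "theta H \<sigma> \<xi> 4 k \<omega> = Y_past H \<sigma> \<xi> (k - 1) \<omega> * Y_past H \<sigma> \<xi> k \<omega>"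
      using k by (auto simp: theta_def Y_past_def)
    then show "(if 3 \<le> k then b0\<^sup>2 / 2 else 0) + (\<Sum>l\<in>{1..m}. ?h k l) \<le> theta H \<sigma> \<xi> 4 k \<omega>"
      using consecutive_product_lower_bound[OF sg m k b0 d] by simp
  qed
  moreover have "(\<Sum>k\<in>{1..n}. (if 3 \<le> k then b0\<^sup>2 / 2 else 0)) = b0\<^sup>2 / 2 * real (n - 2)"
  proof -
    have "(\<Sum>k\<in>{1..n}. (if 3 \<le> k then b0\<^sup>2 / 2 else 0)) = (\<Sum>k\<in>{k \<in> {1..n}. 3 \<le> k}. b0\<^sup>2 / 2)"
      by (rule sum.inter_filter[symmetric]) simp
    also have "{k \<in> {1..n}. 3 \<le> k} = {3..n}" by auto
    finally show ?thesis by simp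
  qed
  moreover have "(\<Sum>k\<in>{1..n}. \<Sum>l\<in>{1..m}. ?h k l) = (\<Sum>l\<in>{1..m}. transform (lag_coef l) (n - l) \<omega>)"
  proof (subst sum.swap, intro sum.cong refl)
    fix l assume l: "l \<in> {1..m}"
    have "(\<Sum>k\<in>{1..n}. ?h k l) = (\<Sum>k\<in>{k \<in> {1..n}. l < k}. \<xi> (k - l) \<omega> * lag_coef l (k - l) \<omega>)"
      by (rule sum.inter_filter[symmetric]) simp
    also have "\<dots> = transform (lag_coef l) (n - l) \<omega>"
      unfolding transform_def
      by (rule sum.reindex_bij_witness[of _ "\<lambda>p. p + l" "\<lambda>k. k - l"]) auto
    finally show "(\<Sum>k\<in>{1..n}. ?h k l) = transform (lag_coef l) (n - l) \<omega>" .
  qed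
  ultimately show ?thesis by (simp add: sum.distrib)
qed

lemma theta_sums_on_calm:
  assumes sg: "\<And>i. 1 \<le> i \<Longrightarrow> (\<xi> i \<omega>)\<^sup>2 = 1"
    and m: "2 \<le> m" and a: "0 < a"
    and b0: "0 \<le> b0" "\<And>n i. 1 \<le> i \<Longrightarrow> i < n \<Longrightarrow> n \<le> i + 2 \<Longrightarrow> b0 \<le> coef_j H \<sigma> n i"
    and d: "\<And>n. (\<Sum>i\<in>{1..<n-m}. \<bar>coef_j H \<sigma> n i - coef_j H \<sigma> (n - 1) i\<bar>) \<le> b0"
    and calm: "calm (m + 3) N a \<omega>" and n: "n \<le> N"
  shows "- a \<le> theta_sum H \<sigma> \<xi> 1 n \<omega>" "- a \<le> theta_sum H \<sigma> \<xi> 2 n \<omega>" "- a \<le> theta_sum H \<sigma> \<xi> 3 n \<omega>"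
    "b0\<^sup>2 / 2 * real (n - 2) - real m * a \<le> theta_sum H \<sigma> \<xi> 4 n \<omega>"
proof -
  have c: "- a \<le> transform (noise_coef i) k \<omega>" if "i < m + 3" "k \<le> N" for i k
    proof -
    have "\<bar>transform (noise_coef i) k \<omega>\<bar> < a" using calm that unfolding calm_def by blast
    then show ?thesis by linarith
  qed
  show "- a \<le> theta_sum H \<sigma> \<xi> 1 n \<omega>" unfolding theta_sum_1 using c[of 0 n] n by (simp add: noise_coef_def)
  show "- a \<le> theta_sum H \<sigma> \<xi> 2 n \<omega>" using c[of 1 n] n by (simp add: theta_sum_2 noise_coef_def)
  show "- a \<le> theta_sum H \<sigma> \<xi> 3 n \<omega>"
  proof (cases n)
    case 0 then show ?thesis using a by (simp add: theta_sum_def)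
  next
    case (Suc k)
    then show ?thesis using c[of 2 k] n theta_sum_3[of k \<omega>] by (simp add: noise_coef_def)
  qed
  have "(\<Sum>l\<in>{1..m}. - a) \<le> (\<Sum>l\<in>{1..m}. transform (lag_coef l) (n - l) \<omega>)"
  proof (rule sum_mono)
    fix l assume "l \<in> {1..m}"
    then show "- a \<le> transform (lag_coef l) (n - l) \<omega>" using c[of "l + 2" "n - l"] n by (simp add: noise_coef_def)
  qed
  then show "b0\<^sup>2 / 2 * real (n - 2) - real m * a \<le> theta_sum H \<sigma> \<xi> 4 n \<omega>"
    using theta_sum_4[OF sg m b0 d, of n] by simp
qed

end

section \<open>The value of the strategy along a path\<close>
lemma bond_position_step:
  assumes "0 \<le> n"
  shows "bond_position S 0 f n \<omega> = bond_position S 0 f (n - 1) \<omega> - (f n \<omega> - f (n - 1) \<omega>) * S (nat n) \<omega>"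
proof -
  have s: "{0..n} = insert n {0..n - 1}" using assms by auto
  have "ppart x * y = x * y + npart x * y" for x y
    by (simp add: ppart_def npart_def max_def algebra_simps)
  then show ?thesis unfolding bond_position_def s by (subst sum.insert, simp, simp)+ (simp add: algebra_simps)
qed

text \<open>Without transaction costs, the liquidation value is the discrete stochastic integral.\<close>
lemma liq_value_bond_position:
  assumes "f (-1) \<omega> = 0"
  shows "liq_value S 0 (bond_position S 0 f) f n \<omega> = (\<Sum>k\<in>{1..n}. f (int k - 1) \<omega> * (S k \<omega> - S (k - 1) \<omega>))"
proof -
  have pn: "ppart x * y - npart x * y = x * y" for x y
    by (simp add: ppart_def npart_def max_def)
  have liq: "liq_value S 0 (bond_position S 0 f) f n \<omega> = bond_position S 0 f (int n) \<omega> + f (int n) \<omega> * S n \<omega>" for n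
    using pn[of "f (int n) \<omega>" "S n \<omega>"] by (simp add: liq_value_def)
  show ?thesis
  proof (induction n)
    case 0
    have "bond_position S 0 f (-1) \<omega> = 0" by (simp add: bond_position_def)
    then show ?case unfolding liq using bond_position_step[of 0 S f \<omega>] assms by simp
  next
    case (Suc n)
    have e: "int (Suc n) - 1 = int n" "nat (int (Suc n)) = Suc n" by simp_all
    have "bond_position S 0 f (int (Suc n)) \<omega> = bond_position S 0 f (int n) \<omega> - (f (int (Suc n)) \<omega> - f (int n) \<omega>) * S (Suc n) \<omega>"
      using bond_position_step[of "int (Suc n)" S f \<omega>] unfolding e by linarith
    then show ?case using Suc.IH unfolding liq by (simp add: algebra_simps)
  qed
qed

lemma eps_nonneg: "1 \<le> N \<Longrightarrow> 0 \<le> eps H N"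
  by (simp add: eps_def)

lemma less_hit_time_iff:
  "enat k < hit_time H \<sigma> \<xi> N i \<omega> \<longleftrightarrow>
     (\<forall>q\<in>{1..N}. q \<le> k \<longrightarrow> \<not> theta_sum H \<sigma> \<xi> i q \<omega> / real N < - eps H N)"
proof -
  let ?A = "{q \<in> {1..N}. theta_sum H \<sigma> \<xi> i q \<omega> / real N < - eps H N}"
  have h: "hit_time H \<sigma> \<xi> N i \<omega> = Inf (enat ` ?A)" by (simp add: hit_time_def)
  show ?thesis
  proof
    assume l: "enat k < hit_time H \<sigma> \<xi> N i \<omega>"
    show "\<forall>q\<in>{1..N}. q \<le> k \<longrightarrow> \<not> theta_sum H \<sigma> \<xi> i q \<omega> / real N < - eps H N"
    proof (intro ballI impI notI)
      fix q assume "q \<in> {1..N}" "q \<le> k" "theta_sum H \<sigma> \<xi> i q \<omega> / real N < - eps H N"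
      then have "hit_time H \<sigma> \<xi> N i \<omega> \<le> enat q" unfolding h by (intro Inf_lower imageI CollectI conjI)
      with l have "enat k < enat q" by (rule less_le_trans)
      with \<open>q \<le> k\<close> show False by simp
    qed
  next
    assume r: "\<forall>q\<in>{1..N}. q \<le> k \<longrightarrow> \<not> theta_sum H \<sigma> \<xi> i q \<omega> / real N < - eps H N"
    show "enat k < hit_time H \<sigma> \<xi> N i \<omega>"
    proof (cases "?A = {}")
      case True
      have "hit_time H \<sigma> \<xi> N i \<omega> = \<infinity>" unfolding h True by (simp add: top_enat_def)
      then show ?thesis by simp
    next
      case False
      then obtain q0 where "q0 \<in> ?A" by blast
      then have "enat q0 \<in> enat ` ?A" by (rule imageI)
      then have "Inf (enat ` ?A) \<in> enat ` ?A" by (rule wellorder_InfI)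
      then obtain q where q: "q \<in> ?A" "Inf (enat ` ?A) = enat q" by (rule imageE) (rule that)
      have "\<not> q \<le> k" using r q(1) by blast
      then have "k < q" by simp
      then show ?thesis unfolding h q(2) by simp
    qed
  qed
qed

lemma less_hit_time_minus_iff: "enat k < h - 1 \<longleftrightarrow> enat (Suc k) < (h::enat)"
  by (cases h) (auto simp: one_enat_def)

text \<open>
  Stopping one step early for \<open>theta 3\<close> and \<open>theta 4\<close> costs no adaptedness, because these terms
  are known one step ahead.
\<close>
lemma less_T_stop_iff:
  "enat k < T_stop H \<sigma> \<xi> N \<omega> \<longleftrightarrow>
     (\<forall>q\<in>{1..N}. (q \<le> k \<longrightarrow> \<not> theta_sum H \<sigma> \<xi> 1 q \<omega> / real N < - eps H N) \<and>
                (q \<le> k \<longrightarrow> \<not> theta_sum H \<sigma> \<xi> 2 q \<omega> / real N < - eps H N) \<and>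
                (q \<le> Suc k \<longrightarrow> \<not> theta_sum H \<sigma> \<xi> 3 q \<omega> / real N < - eps H N) \<and>
                (q \<le> Suc k \<longrightarrow> \<not> theta_sum H \<sigma> \<xi> 4 q \<omega> / real N < - eps H N))"
  unfolding T_stop_def min_less_iff_conj less_hit_time_minus_iff less_hit_time_iff by blast

lemma theta_total:
  assumes "2 \<le> k"
  shows "X_incr H \<sigma> \<xi> (k - 1) \<omega> * X_incr H \<sigma> \<xi> k \<omega>
    = theta H \<sigma> \<xi> 1 k \<omega> + theta H \<sigma> \<xi> 2 k \<omega> + theta H \<sigma> \<xi> 3 k \<omega> + theta H \<sigma> \<xi> 4 k \<omega>"
  using assms unfolding X_incr_def theta_def by (simp add: algebra_simps)

lemma psi_value:
  assumes N: "1 \<le> N" and n: "n \<le> N" and S: "\<forall>k\<in>{0..N}. 0 < stock H \<sigma> s0 \<xi> N k \<omega>"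
  shows "liq_value (stock H \<sigma> s0 \<xi> N) 0 (psi_bond H \<sigma> s0 \<xi> C1 C2 N) (psi_stock H \<sigma> s0 \<xi> C1 C2 N) n \<omega>
    = 1 / sqrt (c_hat H C1 C2 N) * ((\<Sum>k\<in>{1..n}. if enat (k - 1) < T_stop H \<sigma> \<xi> N \<omega>
        then theta H \<sigma> \<xi> 1 k \<omega> + theta H \<sigma> \<xi> 2 k \<omega> + theta H \<sigma> \<xi> 3 k \<omega> + theta H \<sigma> \<xi> 4 k \<omega> else 0) / real N)"
proof -
  have "psi_stock H \<sigma> s0 \<xi> C1 C2 N (-1) \<omega> = 0" by (simp add: psi_stock_def phi_stock_def)
  from liq_value_bond_position[of "psi_stock H \<sigma> s0 \<xi> C1 C2 N", OF this]
  have "liq_value (stock H \<sigma> s0 \<xi> N) 0 (psi_bond H \<sigma> s0 \<xi> C1 C2 N) (psi_stock H \<sigma> s0 \<xi> C1 C2 N) n \<omega>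
    = (\<Sum>k\<in>{1..n}. psi_stock H \<sigma> s0 \<xi> C1 C2 N (int k - 1) \<omega> * (stock H \<sigma> s0 \<xi> N k \<omega> - stock H \<sigma> s0 \<xi> N (k - 1) \<omega>))"
    unfolding psi_bond_def by blast
  also have "\<dots> = (\<Sum>k\<in>{1..n}. 1 / sqrt (c_hat H C1 C2 N) * ((if enat (k - 1) < T_stop H \<sigma> \<xi> N \<omega>
        then theta H \<sigma> \<xi> 1 k \<omega> + theta H \<sigma> \<xi> 2 k \<omega> + theta H \<sigma> \<xi> 3 k \<omega> + theta H \<sigma> \<xi> 4 k \<omega> else 0) / real N))"
  proof (rule sum.cong[OF refl])
    fix k assume k: "k \<in> {1..n}"
    show "psi_stock H \<sigma> s0 \<xi> C1 C2 N (int k - 1) \<omega> * (stock H \<sigma> s0 \<xi> N k \<omega> - stock H \<sigma> s0 \<xi> N (k - 1) \<omega>)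
      = 1 / sqrt (c_hat H C1 C2 N) * ((if enat (k - 1) < T_stop H \<sigma> \<xi> N \<omega>
        then theta H \<sigma> \<xi> 1 k \<omega> + theta H \<sigma> \<xi> 2 k \<omega> + theta H \<sigma> \<xi> 3 k \<omega> + theta H \<sigma> \<xi> 4 k \<omega> else 0) / real N)"
    proof (cases "k = 1")
      case True
      then show ?thesis by (simp add: psi_stock_def phi_stock_def theta_def)
    next
      case False
      with k have k2: "2 \<le> k" by auto
      have nk: "nat (int k - 1) = k - 1" by simp
      obtain l where l: "k = Suc l" using k2 by (cases k) auto
      have Sp: "0 < stock H \<sigma> s0 \<xi> N l \<omega>" using S k n l by auto
      have NN: "real N powr (H - 1) / real N powr H = 1 / real N"
        using N by (simp add: powr_diff[symmetric] powr_minus inverse_eq_divide)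
      have dS: "stock H \<sigma> s0 \<xi> N k \<omega> - stock H \<sigma> s0 \<xi> N (k - 1) \<omega> = X_incr H \<sigma> \<xi> k \<omega> / real N powr H * stock H \<sigma> s0 \<xi> N l \<omega>"
        unfolding l by (simp add: algebra_simps)
      have "phi_stock H \<sigma> s0 \<xi> N (int k - 1) \<omega> * (stock H \<sigma> s0 \<xi> N k \<omega> - stock H \<sigma> s0 \<xi> N (k - 1) \<omega>)
        = (real N powr (H - 1) / real N powr H) * (X_incr H \<sigma> \<xi> (k - 1) \<omega> * X_incr H \<sigma> \<xi> k \<omega>)"
        unfolding dS unfolding phi_stock_def nk using k2 Sp l by (simp add: field_simps)
      then have ph: "phi_stock H \<sigma> s0 \<xi> N (int k - 1) \<omega> * (stock H \<sigma> s0 \<xi> N k \<omega> - stock H \<sigma> s0 \<xi> N (k - 1) \<omega>)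
        = (theta H \<sigma> \<xi> 1 k \<omega> + theta H \<sigma> \<xi> 2 k \<omega> + theta H \<sigma> \<xi> 3 k \<omega> + theta H \<sigma> \<xi> 4 k \<omega>) / real N"
        unfolding NN theta_total[OF k2] by simp
      show ?thesis unfolding psi_stock_def nk mult.assoc ph by simp
    qed
  qed
  finally show ?thesis by (simp only: sum_distrib_left[symmetric] sum_divide_distrib[symmetric])
qed

text \<open>
  The position held at \<open>k - 1\<close> earns the increment \<open>k\<close>, so the gains run up to and including the
  stopping time itself.
\<close>
lemma stopped_sum:
  fixes f :: "nat \<Rightarrow> real" and T :: enat
  obtains t where "t \<le> n" "enat t \<le> T" "n \<le> T \<Longrightarrow> t = n"
    "(\<Sum>k\<in>{1..n}. if enat (k - 1) < T then f k else 0) = (\<Sum>k\<in>{1..t}. f k)"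
proof -
  define t where "t = (if enat n \<le> T then n else the_enat T)"
  have t: "t \<le> n" "enat t \<le> T" "n \<le> T \<Longrightarrow> t = n"
    unfolding t_def by (cases T; simp)+
  have iff: "enat (k - 1) < T \<longleftrightarrow> k \<le> t" if "k \<in> {1..n}" for k
    using that unfolding t_def by (cases T) auto
  have "(\<Sum>k\<in>{1..n}. if enat (k - 1) < T then f k else 0) = (\<Sum>k\<in>{1..n}. if k \<le> t then f k else 0)"
    using iff by (intro sum.cong) auto
  also have "\<dots> = (\<Sum>k\<in>{k \<in> {1..n}. k \<le> t}. f k)" by (rule sum.inter_filter[symmetric]) simp
  also have "{k \<in> {1..n}. k \<le> t} = {1..t}" using t(1) by auto
  finally show ?thesis using that t by blast
qed

lemma c_hat_pos:
  assumes "1 \<le> N" "0 < C1" "0 < C2" shows "0 < c_hat H C1 C2 N"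
  using assms eps_nonneg[of N H] by (simp add: c_hat_def add_nonneg_pos)

text \<open>
  Let \<open>t\<close> be the last time with a gain.  The sums of \<open>theta 3\<close> and \<open>theta 4\<close> have not crossed the
  level \<open>- N * eps\<close> at \<open>t\<close>, because of the subtraction of 1 in the stopping time.  The sums of
  \<open>theta 1\<close> and \<open>theta 2\<close> have not crossed it at \<open>t - 1\<close>, and their last summand is bounded by
  the assumption.  These bounds add up to \<open>- c_hat\<close>, which the scaling turns into \<open>- sqrt c_hat\<close>.
\<close>
lemma psi_value_lower_bound:
  assumes N: "1 \<le> N" and n: "n \<le> N" and C: "0 < C1" "0 < C2"
    and S: "\<forall>k\<in>{0..N}. 0 < stock H \<sigma> s0 \<xi> N k \<omega>"
    and t1: "\<forall>n\<in>{1..N}. \<bar>theta H \<sigma> \<xi> 1 n \<omega>\<bar> \<le> C1 * real N powr (H - 1/2)"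
    and t2: "\<forall>n\<in>{1..N}. \<bar>theta H \<sigma> \<xi> 2 n \<omega>\<bar> \<le> C2 * real N powr (H - 1/2)"
  shows "- sqrt (c_hat H C1 C2 N)
    \<le> liq_value (stock H \<sigma> s0 \<xi> N) 0 (psi_bond H \<sigma> s0 \<xi> C1 C2 N) (psi_stock H \<sigma> s0 \<xi> C1 C2 N) n \<omega>"
proof -
  let ?T = "T_stop H \<sigma> \<xi> N \<omega>" and ?S = "\<lambda>i t. theta_sum H \<sigma> \<xi> i t \<omega>" and ?c = "c_hat H C1 C2 N"
  let ?P = "real N powr (H - 1/2)"
  obtain t where t: "t \<le> n" "enat t \<le> ?T"
    "(\<Sum>k\<in>{1..n}. if enat (k - 1) < ?T
        then theta H \<sigma> \<xi> 1 k \<omega> + theta H \<sigma> \<xi> 2 k \<omega> + theta H \<sigma> \<xi> 3 k \<omega> + theta H \<sigma> \<xi> 4 k \<omega> else 0)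
      = (\<Sum>k\<in>{1..t}. theta H \<sigma> \<xi> 1 k \<omega> + theta H \<sigma> \<xi> 2 k \<omega> + theta H \<sigma> \<xi> 3 k \<omega> + theta H \<sigma> \<xi> 4 k \<omega>)"
    by (rule stopped_sum[of n ?T "\<lambda>k. theta H \<sigma> \<xi> 1 k \<omega> + theta H \<sigma> \<xi> 2 k \<omega> + theta H \<sigma> \<xi> 3 k \<omega> + theta H \<sigma> \<xi> 4 k \<omega>"])
  have e: "0 \<le> eps H N * real N" using eps_nonneg[OF N] by simp
  have P: "0 \<le> C1 * ?P" "0 \<le> C2 * ?P" using C by auto
  have low: "- (eps H N * real N) - C1 * ?P \<le> ?S 1 t \<and> - (eps H N * real N) - C2 * ?P \<le> ?S 2 t
     \<and> - (eps H N * real N) \<le> ?S 3 t \<and> - (eps H N * real N) \<le> ?S 4 t"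
  proof (cases t)
    case 0
    then show ?thesis using e P by (simp add: theta_sum_def)
  next
    case (Suc u)
    have "enat u < ?T" using t(2) Suc by (metis Suc_ile_eq)
    then have no: "q \<in> {1..N} \<Longrightarrow> (q \<le> u \<longrightarrow> \<not> ?S 1 q / real N < - eps H N) \<and> (q \<le> u \<longrightarrow> \<not> ?S 2 q / real N < - eps H N)
      \<and> (q \<le> Suc u \<longrightarrow> \<not> ?S 3 q / real N < - eps H N) \<and> (q \<le> Suc u \<longrightarrow> \<not> ?S 4 q / real N < - eps H N)" for q
      unfolding less_T_stop_iff by blast
    have div: "\<not> x / real N < - eps H N \<longleftrightarrow> - (eps H N * real N) \<le> x" for x
      using N by (simp add: not_less field_simps)
    have tN: "t \<in> {1..N}" using t(1) n Suc by auto
    have u0: "- (eps H N * real N) \<le> ?S 1 u \<and> - (eps H N * real N) \<le> ?S 2 u"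
    proof (cases "u = 0")
      case True
      then show ?thesis using e by (simp add: theta_sum_def)
    next
      case False
      then have "u \<in> {1..N}" using tN Suc by auto
      from no[OF this] show ?thesis unfolding div by simp
    qed
    have inc: "?S i t = ?S i u + theta H \<sigma> \<xi> i t \<omega>" for i using Suc by (simp add: theta_sum_def)
    have "- (C1 * ?P) \<le> theta H \<sigma> \<xi> 1 t \<omega>" "- (C2 * ?P) \<le> theta H \<sigma> \<xi> 2 t \<omega>"
      using t1[rule_format, OF tN] t2[rule_format, OF tN] by linarith+
    moreover have "- (eps H N * real N) \<le> ?S 3 t" "- (eps H N * real N) \<le> ?S 4 t"
      using no[OF tN] Suc unfolding div by auto
    ultimately show ?thesis using u0 inc[of 1] inc[of 2] by linarith
  qed
  have sumS: "(\<Sum>k\<in>{1..t}. theta H \<sigma> \<xi> 1 k \<omega> + theta H \<sigma> \<xi> 2 k \<omega> + theta H \<sigma> \<xi> 3 k \<omega> + theta H \<sigma> \<xi> 4 k \<omega>)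
    = ?S 1 t + ?S 2 t + ?S 3 t + ?S 4 t" by (simp add: theta_sum_def sum.distrib)
  have "?c * real N = 4 * (eps H N * real N) + (C1 + C2) * ?P"
  proof -
    have "real N / real N powr (3/2 - H) = ?P"
      using N powr_diff[of "real N" 1 "3/2 - H"] by simp
    moreover have "c_hat H C1 C2 N * real N = 4 * (eps H N * real N) + (C1 + C2) * (real N / real N powr (3/2 - H))"
      by (simp add: c_hat_def distrib_right)
    ultimately show ?thesis by simp
  qed
  then have "- (?c * real N) \<le> ?S 1 t + ?S 2 t + ?S 3 t + ?S 4 t" using low by (simp add: algebra_simps)
  then have "- ?c \<le> (?S 1 t + ?S 2 t + ?S 3 t + ?S 4 t) / real N" using N by (simp add: field_simps)
  then have "1 / sqrt ?c * (- ?c) \<le> 1 / sqrt ?c * ((?S 1 t + ?S 2 t + ?S 3 t + ?S 4 t) / real N)"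
    using c_hat_pos[OF N C, of H] by (intro mult_left_mono) auto
  moreover have "1 / sqrt ?c * (- ?c) = - sqrt ?c"
    using c_hat_pos[OF N C, of H] by (simp add: real_div_sqrt)
  ultimately show ?thesis unfolding psi_value[OF N n S] t(3) sumS by simp
qed

lemma psi_value_when_not_stopped:
  assumes N: "1 \<le> N" and C: "0 < C1" "0 < C2"
    and S: "\<forall>k\<in>{0..N}. 0 < stock H \<sigma> s0 \<xi> N k \<omega>"
    and low: "\<And>i n. i \<in> {1, 2, 3, 4} \<Longrightarrow> n \<le> N \<Longrightarrow> - (eps H N * real N) \<le> theta_sum H \<sigma> \<xi> i n \<omega>"
  shows "liq_value (stock H \<sigma> s0 \<xi> N) 0 (psi_bond H \<sigma> s0 \<xi> C1 C2 N) (psi_stock H \<sigma> s0 \<xi> C1 C2 N) N \<omega>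
    = 1 / sqrt (c_hat H C1 C2 N) * ((theta_sum H \<sigma> \<xi> 1 N \<omega> + theta_sum H \<sigma> \<xi> 2 N \<omega>
        + theta_sum H \<sigma> \<xi> 3 N \<omega> + theta_sum H \<sigma> \<xi> 4 N \<omega>) / real N)"
proof -
  have no: "\<not> theta_sum H \<sigma> \<xi> i q \<omega> / real N < - eps H N" if "i \<in> {1, 2, 3, 4}" "q \<in> {1..N}" for i q
    using low[OF that(1), of q] that(2) N by (simp add: not_less field_simps)
  have T: "enat k < T_stop H \<sigma> \<xi> N \<omega>" for k
    unfolding less_T_stop_iff by (intro ballI conjI impI no) simp_all
  show ?thesis unfolding psi_value[OF N order_refl S] using T by (simp add: theta_sum_def sum.distrib)
qed

context fractional_market
begin

section \<open>Adaptedness\<close>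
lemma X_incr_adapted: assumes "1 \<le> n" shows "X_incr H \<sigma> \<xi> n \<in> borel_measurable (F n)"
proof -
  have "Y_past H \<sigma> \<xi> n \<in> borel_measurable (F n)" by (rule Y_past_F) simp
  moreover have "\<xi> n \<in> borel_measurable (F n)" using assms by (rule xi_F) simp
  ultimately have "(\<lambda>\<omega>. Y_past H \<sigma> \<xi> n \<omega> + coef_g H \<sigma> n * \<xi> n \<omega>) \<in> borel_measurable (F n)"
    by (intro borel_measurable_add borel_measurable_times borel_measurable_const)
  then show ?thesis by (simp add: X_incr_def[abs_def])
qed

lemma stock_adapted: "stock H \<sigma> s0 \<xi> N n \<in> borel_measurable (F n)"
proof (induction n)
  case 0 then show ?case by simp
next
  case (Suc n)
  have "stock H \<sigma> s0 \<xi> N n \<in> borel_measurable (F (Suc n))" by (rule F_mono[OF Suc.IH]) simp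
  moreover have "X_incr H \<sigma> \<xi> (Suc n) \<in> borel_measurable (F (Suc n))" by (rule X_incr_adapted) simp
  ultimately show ?case
    unfolding stock.simps by (intro borel_measurable_add borel_measurable_times borel_measurable_divide borel_measurable_const)
qed

lemma theta_adapted:
  assumes "1 \<le> k" "k \<le> n" "i = 1 \<or> i = 2" shows "theta H \<sigma> \<xi> i k \<in> borel_measurable (F n)"
proof (cases "k < 2")
  case True
  then have "theta H \<sigma> \<xi> i k = (\<lambda>\<omega>. 0)" by (simp add: fun_eq_iff theta_def)
  then show ?thesis by simp
next
  case False
  have x: "\<xi> k \<in> borel_measurable (F n)" "\<xi> (k - 1) \<in> borel_measurable (F n)"
    using assms False by (auto intro: xi_F)
  have Y: "Y_past H \<sigma> \<xi> (k - 1) \<in> borel_measurable (F n)"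
    using assms by (intro Y_past_F) simp
  from assms(3) show ?thesis
  proof
    assume "i = 1"
    with False have "theta H \<sigma> \<xi> i k = (\<lambda>\<omega>. coef_g H \<sigma> (k - 1) * coef_g H \<sigma> k * \<xi> (k - 1) \<omega> * \<xi> k \<omega>)"
      by (simp add: fun_eq_iff theta_def)
    then show ?thesis by (simp only:) (intro borel_measurable_times borel_measurable_const x)
  next
    assume "i = 2"
    with False have "theta H \<sigma> \<xi> i k = (\<lambda>\<omega>. coef_g H \<sigma> k * \<xi> k \<omega> * Y_past H \<sigma> \<xi> (k - 1) \<omega>)"
      by (simp add: fun_eq_iff theta_def)
    then show ?thesis by (simp only:) (intro borel_measurable_times borel_measurable_const x Y)
  qed
qed

lemma theta_predictable:
  assumes "1 \<le> k" "k \<le> Suc n" "i = 3 \<or> i = 4" shows "theta H \<sigma> \<xi> i k \<in> borel_measurable (F n)"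
proof (cases "k < 2")
  case True
  then have "theta H \<sigma> \<xi> i k = (\<lambda>\<omega>. 0)" by (simp add: fun_eq_iff theta_def)
  then show ?thesis by simp
next
  case False
  have x: "\<xi> (k - 1) \<in> borel_measurable (F n)"
    using assms False by (intro xi_F) auto
  have Y: "Y_past H \<sigma> \<xi> k \<in> borel_measurable (F n)" "Y_past H \<sigma> \<xi> (k - 1) \<in> borel_measurable (F n)"
    using assms by (auto intro: Y_past_F)
  from assms(3) show ?thesis
  proof
    assume "i = 3"
    with False have "theta H \<sigma> \<xi> i k = (\<lambda>\<omega>. coef_g H \<sigma> (k - 1) * \<xi> (k - 1) \<omega> * Y_past H \<sigma> \<xi> k \<omega>)"
      by (simp add: fun_eq_iff theta_def)
    then show ?thesis by (simp only:) (intro borel_measurable_times borel_measurable_const x Y)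
  next
    assume "i = 4"
    with False have "theta H \<sigma> \<xi> i k = (\<lambda>\<omega>. Y_past H \<sigma> \<xi> (k - 1) \<omega> * Y_past H \<sigma> \<xi> k \<omega>)"
      by (simp add: fun_eq_iff theta_def)
    then show ?thesis by (simp only:) (intro borel_measurable_times Y)
  qed
qed

lemma theta_sum_adapted:
  assumes "q \<le> n" "i = 1 \<or> i = 2" shows "theta_sum H \<sigma> \<xi> i q \<in> borel_measurable (F n)"
  unfolding theta_sum_def[abs_def]
proof (rule borel_measurable_sum)
  fix k assume "k \<in> {1..q}"
  then show "theta H \<sigma> \<xi> i k \<in> borel_measurable (F n)" using assms by (intro theta_adapted) auto
qed

lemma theta_sum_predictable:
  assumes "q \<le> Suc n" "i = 3 \<or> i = 4" shows "theta_sum H \<sigma> \<xi> i q \<in> borel_measurable (F n)"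
  unfolding theta_sum_def[abs_def]
proof (rule borel_measurable_sum)
  fix k assume "k \<in> {1..q}"
  then show "theta H \<sigma> \<xi> i k \<in> borel_measurable (F n)" using assms by (intro theta_predictable) auto
qed

lemma T_stop_stopping_time: "Measurable.pred (F k) (\<lambda>\<omega>. enat k < T_stop H \<sigma> \<xi> N \<omega>)"
proof -
  have below: "Measurable.pred (F k) (\<lambda>\<omega>. \<not> f \<omega> / c < d)" if f: "f \<in> borel_measurable (F k)" for f and c d :: real
    by (rule pred_intros_logic(2)[OF borel_measurable_pred_less[OF borel_measurable_divide[OF f borel_measurable_const] borel_measurable_const]])
  show ?thesis
    unfolding less_T_stop_iff
  proof (rule pred_intros_finite(3))
    fix q
    show "Measurable.pred (F k) (\<lambda>\<omega>.
       (q \<le> k \<longrightarrow> \<not> theta_sum H \<sigma> \<xi> 1 q \<omega> / real N < - eps H N) \<and>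
       (q \<le> k \<longrightarrow> \<not> theta_sum H \<sigma> \<xi> 2 q \<omega> / real N < - eps H N) \<and>
       (q \<le> Suc k \<longrightarrow> \<not> theta_sum H \<sigma> \<xi> 3 q \<omega> / real N < - eps H N) \<and>
       (q \<le> Suc k \<longrightarrow> \<not> theta_sum H \<sigma> \<xi> 4 q \<omega> / real N < - eps H N))"
      by (intro pred_intros_logic(3) pred_intros_imp'; rule below;
          (rule theta_sum_adapted, simp, simp; fail | rule theta_sum_predictable, simp, simp))
  qed simp
qed

lemma psi_stock_adapted: "psi_stock H \<sigma> s0 \<xi> C1 C2 N k \<in> borel_measurable (F (nat k))"
proof (cases "k \<le> 0")
  case True
  then have "psi_stock H \<sigma> s0 \<xi> C1 C2 N k = (\<lambda>\<omega>. 0)" by (simp add: fun_eq_iff psi_stock_def phi_stock_def)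
  then show ?thesis by simp
next
  case False
  have "X_incr H \<sigma> \<xi> (nat k) \<in> borel_measurable (F (nat k))" using False by (intro X_incr_adapted) simp
  then have "(\<lambda>\<omega>. real N powr (H - 1) * (X_incr H \<sigma> \<xi> (nat k) \<omega> / stock H \<sigma> s0 \<xi> N (nat k) \<omega>)) \<in> borel_measurable (F (nat k))"
    by (intro borel_measurable_times borel_measurable_divide borel_measurable_const stock_adapted)
  moreover have "phi_stock H \<sigma> s0 \<xi> N k = (\<lambda>\<omega>. real N powr (H - 1) * (X_incr H \<sigma> \<xi> (nat k) \<omega> / stock H \<sigma> s0 \<xi> N (nat k) \<omega>))"
    using False by (simp add: fun_eq_iff phi_stock_def)
  ultimately have phi: "phi_stock H \<sigma> s0 \<xi> N k \<in> borel_measurable (F (nat k))" by (simp only:)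
  have ind: "(\<lambda>\<omega>. if enat (nat k) < T_stop H \<sigma> \<xi> N \<omega> then 1 else 0 :: real) \<in> borel_measurable (F (nat k))"
    by (rule measurable_If[OF borel_measurable_const borel_measurable_const predE[OF T_stop_stopping_time]])
  show ?thesis
    unfolding psi_stock_def[abs_def]
    by (intro borel_measurable_times borel_measurable_const ind phi)
qed

lemma psi_bond_adapted: "psi_bond H \<sigma> s0 \<xi> C1 C2 N k \<in> borel_measurable (F (nat k))"
proof -
  let ?f = "psi_stock H \<sigma> s0 \<xi> C1 C2 N" and ?S = "stock H \<sigma> s0 \<xi> N"
  have d: "(\<lambda>\<omega>. ?f j \<omega> - ?f (j - 1) \<omega>) \<in> borel_measurable (F (nat k))" if "j \<in> {0..k}" for j
    using that by (intro borel_measurable_diff F_mono[OF psi_stock_adapted] nat_mono) auto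
  have p: "(\<lambda>\<omega>. ppart (?f j \<omega> - ?f (j - 1) \<omega>)) \<in> borel_measurable (F (nat k))"
    and n: "(\<lambda>\<omega>. npart (?f j \<omega> - ?f (j - 1) \<omega>)) \<in> borel_measurable (F (nat k))" if "j \<in> {0..k}" for j
    unfolding ppart_def npart_def
    by (intro borel_measurable_max borel_measurable_uminus borel_measurable_const d that)+
  have s: "?S (nat j) \<in> borel_measurable (F (nat k))" if "j \<in> {0..k}" for j
    using that by (intro F_mono[OF stock_adapted] nat_mono) auto
  show ?thesis
    unfolding psi_bond_def bond_position_def[abs_def]
    by (intro borel_measurable_add borel_measurable_uminus borel_measurable_sum borel_measurable_times
        borel_measurable_const p n s) assumption+
qed

lemma psi_self_financing:
  "self_financing M F (stock H \<sigma> s0 \<xi> N) 0 N (psi_bond H \<sigma> s0 \<xi> C1 C2 N) (psi_stock H \<sigma> s0 \<xi> C1 C2 N)"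
  unfolding self_financing_def
proof (intro conjI ballI psi_stock_adapted psi_bond_adapted)
  let ?f = "psi_stock H \<sigma> s0 \<xi> C1 C2 N"
  fix n \<omega> assume n: "n \<in> {0..int N}"
  have "x * y = ppart x * y - npart x * y" for x y
    by (simp add: ppart_def npart_def max_def)
  from this[of "?f n \<omega> - ?f (n - 1) \<omega>" "stock H \<sigma> s0 \<xi> N (nat n) \<omega>"]
  show "psi_bond H \<sigma> s0 \<xi> C1 C2 N n \<omega> - psi_bond H \<sigma> s0 \<xi> C1 C2 N (n - 1) \<omega>
    \<le> - ppart (?f n \<omega> - ?f (n - 1) \<omega>) * stock H \<sigma> s0 \<xi> N (nat n) \<omega>
      + (1 - 0) * npart (?f n \<omega> - ?f (n - 1) \<omega>) * stock H \<sigma> s0 \<xi> N (nat n) \<omega>"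
    using bond_position_step[of n "stock H \<sigma> s0 \<xi> N" ?f \<omega>] n unfolding psi_bond_def by simp
qed

lemma psi_zero_endowment:
  "zero_endowment M (psi_bond H \<sigma> s0 \<xi> C1 C2 N) (psi_stock H \<sigma> s0 \<xi> C1 C2 N)"
  by (simp add: zero_endowment_def psi_bond_def bond_position_def psi_stock_def phi_stock_def)

lemma psi_value_measurable:
  "liq_value (stock H \<sigma> s0 \<xi> N) 0 (psi_bond H \<sigma> s0 \<xi> C1 C2 N) (psi_stock H \<sigma> s0 \<xi> C1 C2 N) n \<in> borel_measurable M"
proof -
  have "psi_bond H \<sigma> s0 \<xi> C1 C2 N (int n) \<in> borel_measurable M" "psi_stock H \<sigma> s0 \<xi> C1 C2 N (int n) \<in> borel_measurable M"
    "stock H \<sigma> s0 \<xi> N n \<in> borel_measurable M"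
    by (rule F_M[OF psi_bond_adapted] F_M[OF psi_stock_adapted] F_M[OF stock_adapted])+
  then show ?thesis
    unfolding liq_value_def[abs_def] ppart_def npart_def
    by (intro borel_measurable_add borel_measurable_diff borel_measurable_times borel_measurable_max
        borel_measurable_uminus borel_measurable_const)
qed

section \<open>Asymptotics\<close>
lemma AE_signs: "AE \<omega> in M. \<forall>i\<ge>1. (\<xi> i \<omega>)\<^sup>2 = 1"
proof -
  have "AE \<omega> in M. 1 \<le> i \<longrightarrow> (\<xi> i \<omega>)\<^sup>2 = 1" for i
  proof (cases "1 \<le> i")
    case True
    from AE_sign[OF this] show ?thesis by eventually_elim auto
  qed simp
  then show ?thesis by (subst AE_all_countable) blast
qed

text \<open>
  By Cauchy-Schwarz, the absolute sum of the coefficients grows at most like \<open>sqrt N\<close>, which is of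
  smaller order than \<open>N powr H\<close>; hence all returns are smaller than 1 in modulus once \<open>N\<close> is large.
\<close>
lemma X_incr_bound:
  assumes K: "\<And>n. (\<Sum>i\<in>{1..<n}. (coef_j H \<sigma> n i)\<^sup>2) \<le> K" and K0: "0 \<le> K"
    and G: "\<And>n. 1 \<le> n \<Longrightarrow> coef_g H \<sigma> n \<le> G"
    and sg: "\<And>i. 1 \<le> i \<Longrightarrow> (\<xi> i \<omega>)\<^sup>2 = 1" and n: "1 \<le> n" "n \<le> N"
  shows "\<bar>X_incr H \<sigma> \<xi> n \<omega>\<bar> \<le> (sqrt K + G) * sqrt (real N)"
proof -
  have abs1: "\<bar>\<xi> i \<omega>\<bar> = 1" if "1 \<le> i" for i using sg[OF that] by (auto simp: power2_eq_1_iff)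
  have g: "0 \<le> coef_g H \<sigma> n" "coef_g H \<sigma> n \<le> G" using coef_g_bounds(1)[OF H sigma n(1)] G[OF n(1)] by auto
  have "\<bar>Y_past H \<sigma> \<xi> n \<omega>\<bar> \<le> (\<Sum>i\<in>{1..<n}. \<bar>coef_j H \<sigma> n i * \<xi> i \<omega>\<bar>)"
    unfolding Y_past_def by (rule sum_abs)
  also have "\<dots> = (\<Sum>i\<in>{1..<n}. coef_j H \<sigma> n i * 1)"
    using abs1 coef_j_nonneg[OF H sigma] by (intro sum.cong refl) (auto simp: abs_mult)
  also have "\<dots> \<le> sqrt (K * real N)"
  proof (rule real_le_rsqrt)
    have "(\<Sum>i\<in>{1..<n}. coef_j H \<sigma> n i * 1)\<^sup>2 \<le> (\<Sum>i\<in>{1..<n}. (coef_j H \<sigma> n i)\<^sup>2) * (\<Sum>i\<in>{1..<n}. 1\<^sup>2)"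
      by (rule Cauchy_Schwarz_ineq_sum)
    also have "\<dots> \<le> K * real N" using n K0 by (intro mult_mono K) (auto intro!: sum_nonneg)
    finally show "(\<Sum>i\<in>{1..<n}. coef_j H \<sigma> n i * 1)\<^sup>2 \<le> K * real N" .
  qed
  finally have Y: "\<bar>Y_past H \<sigma> \<xi> n \<omega>\<bar> \<le> sqrt K * sqrt (real N)" by (simp add: real_sqrt_mult)
  have "\<bar>coef_g H \<sigma> n * \<xi> n \<omega>\<bar> = coef_g H \<sigma> n" using g abs1[OF n(1)] by (simp add: abs_mult)
  also have "\<dots> \<le> G * sqrt (real N)"
  proof -
    have "1 \<le> sqrt (real N)" using n by simp
    then have "G * 1 \<le> G * sqrt (real N)" using g by (intro mult_left_mono) auto
    then show ?thesis using g by simp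
  qed
  finally show ?thesis using Y unfolding X_incr_def by (simp add: distrib_right)
qed

lemma stock_eventually_positive:
  assumes s0: "0 < s0"
  shows "\<exists>N0\<ge>1. \<forall>N\<ge>N0. \<forall>\<omega>. (\<forall>i\<ge>1. (\<xi> i \<omega>)\<^sup>2 = 1) \<longrightarrow> (\<forall>k\<in>{0..N}. 0 < stock H \<sigma> s0 \<xi> N k \<omega>)"
proof -
  obtain K where K: "0 < K" "\<And>n. (\<Sum>i\<in>{1..<n}. (coef_j H \<sigma> n i)\<^sup>2) \<le> K"
    using coef_j_square_sum_bounded[OF H sigma] by blast
  define G where "G = \<sigma> * C_frac H / ((H - 1/2) * (3/2 - H))"
  have G: "coef_g H \<sigma> n \<le> G" if "1 \<le> n" for n
    using coef_g_bounds(2)[OF H sigma that] by (simp add: G_def)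
  have "(\<lambda>N. (sqrt K + G) * real N powr (1/2 - H)) \<longlonglongrightarrow> (sqrt K + G) * 0"
    using H by (intro tendsto_mult tendsto_const tendsto_neg_powr filterlim_real_sequentially) auto
  then have "eventually (\<lambda>N. (sqrt K + G) * real N powr (1/2 - H) < 1) sequentially"
    by (intro order_tendstoD(2)) auto
  then obtain N1 where N1: "\<And>N. N1 \<le> N \<Longrightarrow> (sqrt K + G) * real N powr (1/2 - H) < 1"
    by (auto simp: eventually_sequentially)
  show ?thesis
  proof (intro exI[of _ "max 1 N1"] conjI allI impI ballI)
    fix N \<omega> k assume N: "max 1 N1 \<le> N" and sg: "\<forall>i\<ge>1. (\<xi> i \<omega>)\<^sup>2 = 1" and "k \<in> {0..N}"
    from \<open>k \<in> {0..N}\<close> have "k \<le> N" by simp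
    then show "0 < stock H \<sigma> s0 \<xi> N k \<omega>"
    proof (induction k)
      case 0 then show ?case using s0 by simp
    next
      case (Suc k)
      have N0: "0 < real N" using N by simp
      have "\<bar>X_incr H \<sigma> \<xi> (Suc k) \<omega>\<bar> \<le> (sqrt K + G) * sqrt (real N)"
        using Suc.prems by (intro X_incr_bound[OF K(2) less_imp_le[OF K(1)] G sg[rule_format]]) simp_all
      also have "\<dots> = (sqrt K + G) * real N powr (1/2 - H) * real N powr H"
        using N0 by (simp add: powr_half_sqrt[symmetric] powr_add[symmetric])
      also have "\<dots> < 1 * real N powr H"
        using N N0 by (intro mult_strict_right_mono N1) auto
      finally have "\<bar>X_incr H \<sigma> \<xi> (Suc k) \<omega> / real N powr H\<bar> < 1" using N0 by (simp add: field_simps)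
      then have "0 < 1 + X_incr H \<sigma> \<xi> (Suc k) \<omega> / real N powr H" by linarith
      then show ?case using Suc by simp
    qed
  qed simp
qed

lemma eps_tendsto_0: "eps H \<longlonglongrightarrow> 0"
  unfolding eps_def[abs_def] using H by (intro lim_ln_over_power) auto

lemma c_hat_tendsto_0: "c_hat H C1 C2 \<longlonglongrightarrow> 0"
proof -
  have "(\<lambda>N. (C1 + C2) * real N powr (- (3/2 - H))) \<longlonglongrightarrow> (C1 + C2) * 0"
    using H by (intro tendsto_mult tendsto_const tendsto_neg_powr filterlim_real_sequentially) auto
  then have "(\<lambda>N. (C1 + C2) / real N powr (3/2 - H)) \<longlonglongrightarrow> 0"
    by (simp only: powr_minus divide_inverse mult_zero_right)
  then have "(\<lambda>N. 4 * eps H N + (C1 + C2) / real N powr (3/2 - H)) \<longlonglongrightarrow> 4 * 0 + 0"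
    by (intro tendsto_add tendsto_mult tendsto_const eps_tendsto_0)
  then show ?thesis by (simp add: c_hat_def[abs_def])
qed

text \<open>
  The power of \<open>N\<close> in \<open>eps\<close> is at most \<open>1/2\<close>; the logarithm is what makes \<open>N * eps\<^sup>2\<close> diverge.
\<close>
lemma eps_square_lower_bound: assumes "1 \<le> N" shows "(ln (real N))\<^sup>2 \<le> real N * (eps H N)\<^sup>2"
proof -
  let ?p = "min (1/2) (2 - 2 * H)"
  have "(real N powr ?p)\<^sup>2 = real N powr (2 * ?p)"
    by (simp add: power2_eq_square powr_add[symmetric])
  also have "\<dots> \<le> real N powr 1" 
    using assms min.cobounded1[of "1/2" "2 - 2 * H"] by (intro powr_mono) auto
  finally have P: "(real N powr ?p)\<^sup>2 \<le> real N" by simp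
  have pos: "0 < (real N powr ?p)\<^sup>2" using assms by simp
  have "real N * (eps H N)\<^sup>2 = (ln (real N))\<^sup>2 * (real N / (real N powr ?p)\<^sup>2)"
    by (simp add: eps_def power_divide)
  moreover have "(ln (real N))\<^sup>2 * 1 \<le> (ln (real N))\<^sup>2 * (real N / (real N powr ?p)\<^sup>2)"
    using P pos by (intro mult_left_mono) auto
  ultimately show ?thesis by simp
qed

lemma not_calm_tendsto_0:
  assumes c: "\<And>i p. 1 \<le> p \<Longrightarrow> expectation (\<lambda>\<omega>. (noise_coef i p \<omega>)\<^sup>2) \<le> c" and c0: "0 < c" and L: "0 < L"
  shows "(\<lambda>N. prob {\<omega> \<in> space M. \<not> calm L N (eps H N * real N / real L) \<omega>}) \<longlonglongrightarrow> 0"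
proof (rule tendsto_sandwich[OF _ _ tendsto_const])
  let ?D = "real L ^ 3 * c"
  have "filterlim (\<lambda>N. ln (real N) ^ 2) at_top sequentially"
    by (intro filterlim_pow_at_top filterlim_compose[OF ln_at_top filterlim_real_sequentially]) simp
  then show "(\<lambda>N. ?D / (ln (real N))\<^sup>2) \<longlonglongrightarrow> 0"
    by (intro tendsto_divide_0[OF tendsto_const] filterlim_at_top_imp_at_infinity)
  show "\<forall>\<^sub>F N in sequentially. prob {\<omega> \<in> space M. \<not> calm L N (eps H N * real N / real L) \<omega>} \<le> ?D / (ln (real N))\<^sup>2"
    using eventually_ge_at_top[of 2]
  proof eventually_elim
    fix N :: nat assume N: "2 \<le> N"
    have ln0: "0 < ln (real N)" using N by simp
    have e0: "0 < eps H N" using N by (simp add: eps_def)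
    let ?a = "eps H N * real N / real L"
    have a: "0 < ?a" using e0 N L by simp
    have "prob {\<omega> \<in> space M. \<not> calm L N ?a \<omega>} \<le> real L * (real N * c / ?a\<^sup>2)"
      by (rule prob_not_calm(2)[OF c a])
    also have "\<dots> = ?D / (real N * (eps H N)\<^sup>2)"
      using e0 N L by (simp add: field_simps power2_eq_square power3_eq_cube)
    also have "\<dots> \<le> ?D / (ln (real N))\<^sup>2"
      using eps_square_lower_bound[of N] N ln0 c0 e0 by (intro divide_left_mono mult_pos_pos) auto
    finally show "prob {\<omega> \<in> space M. \<not> calm L N ?a \<omega>} \<le> ?D / (ln (real N))\<^sup>2" .
  qed
qed simp

text \<open>
  If each of the \<open>m + 3\<close> martingales stays within \<open>N * eps / (m + 3)\<close>, then no sum crosses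
  \<open>- N * eps\<close>, and all of them together reduce the drift by at most \<open>N * eps\<close>.
\<close>
lemma psi_value_on_calm:
  assumes N: "1 \<le> N" and C: "0 < C1" "0 < C2" and a: "0 < eps H N"
    and S: "\<forall>k\<in>{0..N}. 0 < stock H \<sigma> s0 \<xi> N k \<omega>"
    and sg: "\<And>i. 1 \<le> i \<Longrightarrow> (\<xi> i \<omega>)\<^sup>2 = 1"
    and m: "2 \<le> m"
    and b0: "0 \<le> b0" "\<And>n i. 1 \<le> i \<Longrightarrow> i < n \<Longrightarrow> n \<le> i + 2 \<Longrightarrow> b0 \<le> coef_j H \<sigma> n i"
    and d: "\<And>n. (\<Sum>i\<in>{1..<n-m}. \<bar>coef_j H \<sigma> n i - coef_j H \<sigma> (n - 1) i\<bar>) \<le> b0"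
    and calm: "calm (m + 3) N (eps H N * real N / real (m + 3)) \<omega>"
  shows "1 / sqrt (c_hat H C1 C2 N) * (b0\<^sup>2 / 2 * (1 - 2 / real N) - eps H N)
    \<le> liq_value (stock H \<sigma> s0 \<xi> N) 0 (psi_bond H \<sigma> s0 \<xi> C1 C2 N) (psi_stock H \<sigma> s0 \<xi> C1 C2 N) N \<omega>"
proof -
  define a where "a = eps H N * real N / real (m + 3)"
  have N0: "0 < real N" using N by simp
  have a0: "0 < a" using assms(4) N0 by (simp add: a_def)
  have am: "eps H N * real N = (real m + 3) * a" by (simp add: a_def)
  have low: "- a \<le> theta_sum H \<sigma> \<xi> 1 n \<omega>" "- a \<le> theta_sum H \<sigma> \<xi> 2 n \<omega>" "- a \<le> theta_sum H \<sigma> \<xi> 3 n \<omega>"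
    "b0\<^sup>2 / 2 * real (n - 2) - real m * a \<le> theta_sum H \<sigma> \<xi> 4 n \<omega>" if "n \<le> N" for n
    by (rule theta_sums_on_calm[OF sg m a0 b0 d calm[folded a_def] that]; assumption)+
  have le: "- (eps H N * real N) \<le> - a" "- (eps H N * real N) \<le> - (real m * a)"
  proof -
    have "0 \<le> real m * a" using a0 by simp
    then show "- (eps H N * real N) \<le> - a" "- (eps H N * real N) \<le> - (real m * a)"
      unfolding am distrib_right using a0 by linarith+
  qed
  have b2: "0 \<le> b0\<^sup>2 / 2 * real (n - 2)" for n by simp
  have below: "- (eps H N * real N) \<le> theta_sum H \<sigma> \<xi> i n \<omega>" if "i \<in> {1, 2, 3, 4}" "n \<le> N" for i n
  proof -
    have "- (eps H N * real N) \<le> theta_sum H \<sigma> \<xi> 1 n \<omega>" "- (eps H N * real N) \<le> theta_sum H \<sigma> \<xi> 2 n \<omega>"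
      "- (eps H N * real N) \<le> theta_sum H \<sigma> \<xi> 3 n \<omega>" "- (eps H N * real N) \<le> theta_sum H \<sigma> \<xi> 4 n \<omega>"
      using low[OF that(2)] le b2[of n] by linarith+
    then show ?thesis using that(1) by (elim insertE) (simp_all only: empty_iff)
  qed
  let ?sum = "theta_sum H \<sigma> \<xi> 1 N \<omega> + theta_sum H \<sigma> \<xi> 2 N \<omega> + theta_sum H \<sigma> \<xi> 3 N \<omega> + theta_sum H \<sigma> \<xi> 4 N \<omega>"
  have "b0\<^sup>2 / 2 * (real N - 2) \<le> b0\<^sup>2 / 2 * real (N - 2)" by (intro mult_left_mono) auto
  then have "b0\<^sup>2 / 2 * (real N - 2) - eps H N * real N \<le> ?sum"
    using low[OF order_refl] unfolding am by (simp add: algebra_simps)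
  then have "(b0\<^sup>2 / 2 * (real N - 2) - eps H N * real N) / real N \<le> ?sum / real N"
    using N0 by (intro divide_right_mono) auto
  moreover have "(b0\<^sup>2 / 2 * (real N - 2) - eps H N * real N) / real N = b0\<^sup>2 / 2 * (1 - 2 / real N) - eps H N"
    using N0 by (simp add: field_simps)
  ultimately have "1 / sqrt (c_hat H C1 C2 N) * (b0\<^sup>2 / 2 * (1 - 2 / real N) - eps H N) \<le> 1 / sqrt (c_hat H C1 C2 N) * (?sum / real N)"
    using c_hat_pos[OF N C, of H] by (intro mult_left_mono) auto
  also have "\<dots> = liq_value (stock H \<sigma> s0 \<xi> N) 0 (psi_bond H \<sigma> s0 \<xi> C1 C2 N) (psi_stock H \<sigma> s0 \<xi> C1 C2 N) N \<omega>"
    by (rule psi_value_when_not_stopped[OF N C S below, symmetric])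
  finally show ?thesis .
qed

section \<open>Strong asymptotic arbitrage\<close>

text \<open>
  The lower bounds are \<open>sqrt c_hat\<close>.  The upper thresholds are \<open>b0\<^sup>2 / (4 * sqrt c_hat)\<close>: half of
  the drift \<open>b0\<^sup>2 / 2\<close> absorbs, for large \<open>N\<close>, both \<open>eps\<close> and the first two steps, which carry no
  drift.
\<close>
lemma psi_provides_SAA:
  assumes C: "0 < C1" "0 < C2"
    and t1: "\<forall>N\<ge>1. AE \<omega> in M. \<forall>n\<in>{1..N}. \<bar>theta H \<sigma> \<xi> 1 n \<omega>\<bar> \<le> C1 * real N powr (H - 1/2)"
    and t2: "\<forall>N\<ge>1. AE \<omega> in M. \<forall>n\<in>{1..N}. \<bar>theta H \<sigma> \<xi> 2 n \<omega>\<bar> \<le> C2 * real N powr (H - 1/2)"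
    and N0: "1 \<le> N0" and S: "\<forall>N\<ge>N0. AE \<omega> in M. \<forall>k\<in>{0..N}. 0 < stock H \<sigma> s0 \<xi> N k \<omega>"
  shows "provides_SAA M F (stock H \<sigma> s0 \<xi>) (\<lambda>N. 0) (\<lambda>m. N0 + m)
         (psi_bond H \<sigma> s0 \<xi> C1 C2) (psi_stock H \<sigma> s0 \<xi> C1 C2)"
proof -
  let ?V = "\<lambda>N. liq_value (stock H \<sigma> s0 \<xi> N) 0 (psi_bond H \<sigma> s0 \<xi> C1 C2 N) (psi_stock H \<sigma> s0 \<xi> C1 C2 N)"
  let ?ch = "c_hat H C1 C2"
  \<comment> \<open>One constant serves as lower bound of recent coefficients and as tolerance for remote ones.\<close>
  define b0 where "b0 = \<sigma> * C_frac H * 3 powr (H - 3/2)"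
  have b0: "0 < b0" using sigma C_frac_pos[OF H] by (simp add: b0_def)
  have b0_le: "b0 \<le> coef_j H \<sigma> n i" if "1 \<le> i" "i < n" "n \<le> i + 2" for n i
    unfolding b0_def by (rule coef_j_ge[OF H sigma that])
  obtain m where m: "2 \<le> m"
    "\<And>n. (\<Sum>i\<in>{1..<n-m}. \<bar>coef_j H \<sigma> n i - coef_j H \<sigma> (n - 1) i\<bar>) \<le> b0"
    using coef_j_remote_increments_small[OF H sigma b0] by blast
  obtain c where c: "0 < c" "\<And>i p. 1 \<le> p \<Longrightarrow> expectation (\<lambda>\<omega>. (noise_coef i p \<omega>)\<^sup>2) \<le> c"
    using noise_second_moments_bounded by blast
  define Cs where "Cs N = b0\<^sup>2 / 4 * (1 / sqrt (?ch N))" for N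
  have ch_pos: "0 < ?ch N" if "1 \<le> N" for N using c_hat_pos[OF that C] .
  have sqrt_ch: "(\<lambda>N. sqrt (?ch N)) \<longlonglongrightarrow> 0"
    using tendsto_real_sqrt[OF c_hat_tendsto_0[of C1 C2]] by simp
  have Cs_top: "filterlim Cs at_top sequentially"
  proof -
    have "\<forall>\<^sub>F N in sequentially. 0 < sqrt (?ch N)"
      using eventually_ge_at_top[of 1] by eventually_elim (simp add: ch_pos)
    then have "filterlim (\<lambda>N. inverse (sqrt (?ch N))) at_top sequentially"
      by (rule filterlim_inverse_at_top[OF sqrt_ch])
    then have "filterlim (\<lambda>N. b0\<^sup>2 / 4 * inverse (sqrt (?ch N))) at_top sequentially"
      using b0 by (intro filterlim_tendsto_pos_mult_at_top[OF tendsto_const]) auto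
    then show ?thesis by (simp add: Cs_def[abs_def] inverse_eq_divide)
  qed
  let ?A = "\<lambda>N. {\<omega> \<in> space M. \<not> calm (m + 3) N (eps H N * real N / real (m + 3)) \<omega>}"
  let ?W = "\<lambda>N. {\<omega> \<in> space M. Cs N \<le> ?V N N \<omega>}"
  have W_events: "?W N \<in> events" for N
    by (rule borel_measurable_le[OF borel_measurable_const psi_value_measurable])
  have "(\<lambda>N. b0\<^sup>2 / 2 * (1 - 2 / real N) - eps H N) \<longlonglongrightarrow> b0\<^sup>2 / 2 * (1 - 0) - 0"
    by (intro tendsto_diff tendsto_mult tendsto_const eps_tendsto_0 tendsto_divide_0[OF tendsto_const]
        filterlim_at_top_imp_at_infinity filterlim_real_sequentially)
  then have drift: "\<forall>\<^sub>F N in sequentially. b0\<^sup>2 / 4 < b0\<^sup>2 / 2 * (1 - 2 / real N) - eps H N"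
    using b0 by (intro order_tendstoD(1)) auto
  have win: "\<forall>\<^sub>F N in sequentially. 1 - prob (?A N) \<le> prob (?W N)"
    using drift eventually_ge_at_top[of "max 2 N0"]
  proof eventually_elim
    fix N assume dr: "b0\<^sup>2 / 4 < b0\<^sup>2 / 2 * (1 - 2 / real N) - eps H N" and N: "max 2 N0 \<le> N"
    have N1: "1 \<le> N" and e0: "0 < eps H N" using N by (auto simp: eps_def)
    have a0: "0 < eps H N * real N / real (m + 3)" using e0 N1 by simp
    have A: "?A N \<in> events" by (rule prob_not_calm(1)[OF c(2) a0])
    have SN: "AE \<omega> in M. \<forall>k\<in>{0..N}. 0 < stock H \<sigma> s0 \<xi> N k \<omega>" using S N by simp
    have "1 - prob (?A N) = prob (space M - ?A N)" by (rule prob_compl[OF A, symmetric])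
    also have "\<dots> \<le> prob (?W N)"
    proof (rule finite_measure_mono_AE[OF _ W_events])
      show "AE \<omega> in M. \<omega> \<in> space M - ?A N \<longrightarrow> \<omega> \<in> ?W N"
        using SN AE_signs
      proof eventually_elim
        fix \<omega> assume pos: "\<forall>k\<in>{0..N}. 0 < stock H \<sigma> s0 \<xi> N k \<omega>" and sg: "\<forall>i\<ge>1. (\<xi> i \<omega>)\<^sup>2 = 1"
        show "\<omega> \<in> space M - ?A N \<longrightarrow> \<omega> \<in> ?W N"
        proof
          assume om: "\<omega> \<in> space M - ?A N"
          then have cm: "calm (m + 3) N (eps H N * real N / real (m + 3)) \<omega>" by blast
          have "Cs N = 1 / sqrt (?ch N) * (b0\<^sup>2 / 4)" by (simp add: Cs_def)
          also have "\<dots> \<le> 1 / sqrt (?ch N) * (b0\<^sup>2 / 2 * (1 - 2 / real N) - eps H N)"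
            using dr ch_pos[OF N1] by (intro mult_left_mono) auto
          also have "\<dots> \<le> ?V N N \<omega>"
            by (rule psi_value_on_calm[OF N1 C e0 pos sg[rule_format] m(1) less_imp_le[OF b0] b0_le m(2) cm])
          finally show "\<omega> \<in> ?W N" using om by blast
        qed
      qed
    qed
    finally show "1 - prob (?A N) \<le> prob (?W N)" .
  qed
  have "(\<lambda>N. 1 - prob (?A N)) \<longlonglongrightarrow> 1 - 0"
    by (intro tendsto_diff tendsto_const not_calm_tendsto_0[OF c(2) c(1)]) simp_all
  then have "(\<lambda>N. 1 - prob (?A N)) \<longlonglongrightarrow> 1" by simp
  from tendsto_sandwich[OF win _ this tendsto_const] have W1: "(\<lambda>N. prob (?W N)) \<longlonglongrightarrow> 1" by simp
  have shift: "filterlim (\<lambda>k. N0 + k) sequentially sequentially"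
    by (rule filterlim_subseq) (simp add: strict_mono_def)
  have low: "AE \<omega> in M. \<forall>i\<in>{0..N0 + k}. ?V (N0 + k) i \<omega> \<ge> - sqrt (?ch (N0 + k))" for k
  proof -
    let ?N = "N0 + k"
    have N1: "1 \<le> ?N" "N0 \<le> ?N" using N0 by auto
    show ?thesis
      using S[rule_format, OF N1(2)] t1[rule_format, OF N1(1)] t2[rule_format, OF N1(1)]
    proof eventually_elim
      fix \<omega>
      assume pos: "\<forall>k\<in>{0..?N}. 0 < stock H \<sigma> s0 \<xi> ?N k \<omega>"
        and u1: "\<forall>n\<in>{1..?N}. \<bar>theta H \<sigma> \<xi> 1 n \<omega>\<bar> \<le> C1 * real ?N powr (H - 1/2)"
        and u2: "\<forall>n\<in>{1..?N}. \<bar>theta H \<sigma> \<xi> 2 n \<omega>\<bar> \<le> C2 * real ?N powr (H - 1/2)"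
      show "\<forall>i\<in>{0..?N}. ?V ?N i \<omega> \<ge> - sqrt (?ch ?N)"
      proof
        fix i assume "i \<in> {0..?N}"
        then have "i \<le> ?N" by simp
        then show "?V ?N i \<omega> \<ge> - sqrt (?ch ?N)"
          by (rule psi_value_lower_bound[OF N1(1) _ C pos u1 u2])
      qed
    qed
  qed
  have sqrt_pos: "0 < sqrt (?ch (N0 + k))" and Cs_pos: "0 < Cs (N0 + k)" for k
    using ch_pos[of "N0 + k"] N0 b0 by (simp_all add: Cs_def)
  show ?thesis
    unfolding provides_SAA_def
  proof (intro conjI allI)
    show "strict_mono (\<lambda>m. N0 + m)" by (simp add: strict_mono_def)
    show "\<exists>c C :: nat \<Rightarrow> real.
        (\<forall>k. 0 < c k \<and> 0 < C k) \<and> c \<longlonglongrightarrow> 0 \<and> filterlim C at_top sequentially \<and>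
        (\<forall>k. AE \<omega> in M. \<forall>i\<in>{0..N0 + k}. ?V (N0 + k) i \<omega> \<ge> - c k) \<and>
        (\<lambda>k. prob {\<omega> \<in> space M. ?V (N0 + k) (N0 + k) \<omega> \<ge> C k}) \<longlonglongrightarrow> 1"
      by (rule exI[of _ "\<lambda>k. sqrt (?ch (N0 + k))"], rule exI[of _ "\<lambda>k. Cs (N0 + k)"],
          intro conjI allI sqrt_pos Cs_pos low filterlim_compose[OF sqrt_ch shift]
            filterlim_compose[OF Cs_top shift] filterlim_compose[OF W1 shift])
  qed (use N0 psi_self_financing psi_zero_endowment in simp_all)
qed

end

lemma rademacher_of_fair_signs:
  fixes M :: "'a measure" and \<xi> :: "nat \<Rightarrow> 'a \<Rightarrow> real"
  assumes P: "prob_space M" and ind: "prob_space.indep_vars M (\<lambda>_. borel) \<xi> {1..}"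
    and d: "\<forall>i\<ge>1. distr M borel (\<xi> i) = distr M borel (\<xi> 1)"
    and p: "measure M {\<omega> \<in> space M. \<xi> 1 \<omega> = 1} = 1/2"
    and n: "measure M {\<omega> \<in> space M. \<xi> 1 \<omega> = -1} = 1/2"
  shows "rademacher M \<xi>"
proof -
  interpret prob_space M by (rule P)
  have meas: "\<xi> i \<in> borel_measurable M" if "1 \<le> i" for i
    using ind that unfolding indep_vars_def by blast
  have pt: "prob {\<omega> \<in> space M. \<xi> i \<omega> = x} = prob {\<omega> \<in> space M. \<xi> 1 \<omega> = x}" if i: "1 \<le> i" for i x
  proof -
    have v: "prob {\<omega> \<in> space M. \<xi> i \<omega> = x} = measure (distr M borel (\<xi> i)) {x}" if "1 \<le> i" for i
    proof -
      have "\<xi> i -` {x} \<inter> space M = {\<omega> \<in> space M. \<xi> i \<omega> = x}" by blast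
      then show ?thesis using measure_distr[OF meas[OF that], of "{x}"] by simp
    qed
    have "distr M borel (\<xi> i) = distr M borel (\<xi> 1)" using d i by blast
    then show ?thesis using v[OF i] v[OF order_refl] by simp
  qed
  have ev: "{\<omega> \<in> space M. \<xi> i \<omega> = x} \<in> events" if "1 \<le> i" for i x
    using meas[OF that] by (rule borel_measurable_eq[OF _ borel_measurable_const])
  have AE1: "AE \<omega> in M. \<xi> i \<omega> = 1 \<or> \<xi> i \<omega> = -1" if i: "1 \<le> i" for i
  proof -
    have "prob ({\<omega> \<in> space M. \<xi> i \<omega> = 1} \<union> {\<omega> \<in> space M. \<xi> i \<omega> = -1}) = 1"
    proof (subst finite_measure_Union[OF ev[OF i] ev[OF i]])
      show "{\<omega> \<in> space M. \<xi> i \<omega> = 1} \<inter> {\<omega> \<in> space M. \<xi> i \<omega> = -1} = {}" by auto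
      show "prob {\<omega> \<in> space M. \<xi> i \<omega> = 1} + prob {\<omega> \<in> space M. \<xi> i \<omega> = -1} = 1"
        unfolding pt[OF i] p n by simp
    qed
    moreover have "{\<omega> \<in> space M. \<xi> i \<omega> = 1} \<union> {\<omega> \<in> space M. \<xi> i \<omega> = -1} \<in> events"
      by (rule sets.Un[OF ev[OF i] ev[OF i]])
    ultimately have "AE \<omega> in M. \<omega> \<in> {\<omega> \<in> space M. \<xi> i \<omega> = 1} \<union> {\<omega> \<in> space M. \<xi> i \<omega> = -1}"
      by (simp only: prob_eq_1)
    then show ?thesis by eventually_elim auto
  qed
  have mean: "expectation (\<xi> i) = 0" if i: "1 \<le> i" for i
  proof -
    let ?I = "\<lambda>x. indicator {\<omega> \<in> space M. \<xi> i \<omega> = x} :: 'a \<Rightarrow> real"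
    have I: "integrable M (?I x)" "expectation (?I x) = prob {\<omega> \<in> space M. \<xi> i \<omega> = x}" for x
      using ev[OF i, of x] by (simp_all add: integrable_indicator_iff less_top[symmetric])
    have "AE \<omega> in M. \<xi> i \<omega> = ?I 1 \<omega> - ?I (-1) \<omega>"
      using AE1[OF i] AE_space by eventually_elim (auto simp: indicator_def)
    then have "expectation (\<xi> i) = expectation (\<lambda>\<omega>. ?I 1 \<omega> - ?I (-1) \<omega>)"
      using meas[OF i] borel_measurable_indicator[OF ev[OF i, of 1]] borel_measurable_indicator[OF ev[OF i, of "-1"]]
      by (intro integral_cong_AE borel_measurable_diff) assumption+
    also have "\<dots> = expectation (?I 1) - expectation (?I (-1))"
      by (rule Bochner_Integration.integral_diff[OF I(1) I(1)])
    also have "\<dots> = 1/2 - 1/2" unfolding I(2) pt[OF i] p n ..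
    finally show ?thesis by simp
  qed
  show ?thesis
    by unfold_locales (fact ind, rule AE1, assumption, rule mean)
qed

theorem theorem3p13:
  fixes M :: "'a measure" and \<xi> :: "nat \<Rightarrow> 'a \<Rightarrow> real"
    and H \<sigma> s0 C1 C2 :: real
  assumes "prob_space M"
    and "1/2 < H" and "H < 1" and "0 < \<sigma>" and "0 < s0"
    and "prob_space.indep_vars M (\<lambda>_. borel) \<xi> {1..}"
    and "\<forall>i\<ge>1. distr M borel (\<xi> i) = distr M borel (\<xi> 1)"
    and "measure M {\<omega> \<in> space M. \<xi> 1 \<omega> = 1} = 1/2"
    and "measure M {\<omega> \<in> space M. \<xi> 1 \<omega> = -1} = 1/2"
    and "0 < C1" and "0 < C2"
    and "\<forall>N\<ge>1. AE \<omega> in M. \<forall>n\<in>{1..N}. \<bar>theta H \<sigma> \<xi> 1 n \<omega>\<bar> \<le> C1 * real N powr (H - 1/2)"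
    and "\<forall>N\<ge>1. AE \<omega> in M. \<forall>n\<in>{1..N}. \<bar>theta H \<sigma> \<xi> 2 n \<omega>\<bar> \<le> C2 * real N powr (H - 1/2)"
  shows "(\<exists>N0\<ge>1. \<forall>N\<ge>N0. AE \<omega> in M. \<forall>k\<in>{0..N}. 0 < stock H \<sigma> s0 \<xi> N k \<omega>) \<and>
    (\<forall>N0\<ge>1. (\<forall>N\<ge>N0. AE \<omega> in M. \<forall>k\<in>{0..N}. 0 < stock H \<sigma> s0 \<xi> N k \<omega>) \<longrightarrow>
       provides_SAA M (nat_filt M \<xi>) (stock H \<sigma> s0 \<xi>) (\<lambda>N. 0) (\<lambda>m. N0 + m)
         (psi_bond H \<sigma> s0 \<xi> C1 C2) (psi_stock H \<sigma> s0 \<xi> C1 C2))"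
proof -
  interpret rademacher M \<xi> by (rule rademacher_of_fair_signs) fact+
  interpret fractional_market M \<xi> H \<sigma> by unfold_locales fact+
  have "\<exists>N0\<ge>1. \<forall>N\<ge>N0. AE \<omega> in M. \<forall>k\<in>{0..N}. 0 < stock H \<sigma> s0 \<xi> N k \<omega>"
  proof -
    obtain N0 where N0: "1 \<le> N0"
      "\<forall>N\<ge>N0. \<forall>\<omega>. (\<forall>i\<ge>1. (\<xi> i \<omega>)\<^sup>2 = 1) \<longrightarrow> (\<forall>k\<in>{0..N}. 0 < stock H \<sigma> s0 \<xi> N k \<omega>)"
      using stock_eventually_positive[OF assms(5)] by blast
    have "AE \<omega> in M. \<forall>k\<in>{0..N}. 0 < stock H \<sigma> s0 \<xi> N k \<omega>" if "N0 \<le> N" for N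
      using AE_signs by eventually_elim (use N0(2) that in blast)
    then show ?thesis using N0(1) by blast
  qed
  moreover have "\<forall>N0\<ge>1. (\<forall>N\<ge>N0. AE \<omega> in M. \<forall>k\<in>{0..N}. 0 < stock H \<sigma> s0 \<xi> N k \<omega>) \<longrightarrow>
       provides_SAA M (nat_filt M \<xi>) (stock H \<sigma> s0 \<xi>) (\<lambda>N. 0) (\<lambda>m. N0 + m)
         (psi_bond H \<sigma> s0 \<xi> C1 C2) (psi_stock H \<sigma> s0 \<xi> C1 C2)"
    by (intro allI impI) (rule psi_provides_SAA[OF assms(10-13)])
  ultimately show ?thesis by blast
qed

end
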